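(* Let $\alpha_1,\ldots,\alpha_\ell\in\mathbb{R}$ with $\ell\ge 2$. Assume that $\alpha_1,\ldots,\alpha_\ell$ are $\mathbb{Q}_+$-independent $(\mathrm{mod}\ 1)$. Let $K\subset\mathbb{T}$ be an $(\alpha_1,\ldots,\alpha_\ell)$-set. Then the following statements hold. (i) If $\ell=2$, then either $K-K=\mathbb{T}$ or $K$ has a non-empty interior; in particular, $\underline{\dim}_B K\ge 1/2$. (ii) If $\ell\ge 2$, then $$\underline{\dim}_B K\ge\begin{cases}1, & \text{if } r=1,\\ 1/(r+1), & \text{if } r>1,\end{cases}$$ where $r=\dim\mathrm{span}_{\mathbb{Q}}(1,\alpha_1,\ldots,\alpha_\ell)-1$.
   Context: $\mathbb{T}=\mathbb{R}/\mathbb{Z}$ is the unit circle (viewed as $[0,1]$ with endpoints identified), and $\pi:\mathbb{R}\to\mathbb{T}$ is the canonical map $x\mapsto\{x\}$ (fractional part). A non-empty closed set $K\subset\mathbb{T}$ is called an $(\alpha_1,\ldots,\alpha_\ell)$-set if $K\subset\bigcup_{i=1}^\ell (K-\pi(\alpha_i))$; equivalently, whenever $x\in K$ there exists $i\in\{1,\ldots,\ell\}$ with $x+\pi(\alpha_i)\in K$. Let $\mathbb{Q}_+$ be the set of non-negative rational numbers. The numbers $\alpha_1,\ldots,\alpha_\ell$ are $\mathbb{Q}_+$-independent $(\mathrm{mod}\ 1)$ if the equation $t_1\alpha_1+\cdots+t_\ell\alpha_\ell\equiv 0\ (\mathrm{mod}\ 1)$ in the variables $t_1,\ldots,t_\ell$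 has $(0,\ldots,0)$ as its unique solution in $\mathbb{Q}_+^\ell$. $K-K=\{x-y: x,y\in K\}$ is the algebraic difference in $\mathbb{T}$. $\underline{\dim}_B$ denotes lower box-counting dimension. For real numbers $u_1,\dots,u_k$, $\mathrm{span}_{\mathbb{Q}}(u_1,\ldots,u_k)=\{\sum_{i=1}^k t_iu_i: t_i\in\mathbb{Q}\}$, with dimension taken over $\mathbb{Q}$. *)

theory Defs
  imports "HOL-Analysis.Analysis"
begin

section \<open>The circle \<open>\<real>/\<int>\<close>\<close>

text \<open>The abstraction map \<open>to_circle\<close> is the canonical projection \<open>\<pi>\<close>.\<close>

quotient_type circle = real / "\<lambda>x y::real. x - y \<in> \<int>"
  morphisms rep_circle to_circle
proof (rule equivpI)
  show "reflp (\<lambda>x y::real. x - y \<in> \<int>)"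
    by (simp add: reflp_def)
  show "symp (\<lambda>x y::real. x - y \<in> \<int>)"
    by (rule sympI) (metis Ints_minus minus_diff_eq)
  show "transp (\<lambda>x y::real. x - y \<in> \<int>)"
  proof (rule transpI)
    fix x y z :: real
    assume "x - y \<in> \<int>" "y - z \<in> \<int>"
    then have "(x - y) + (y - z) \<in> \<int>" by (rule Ints_add)
    then show "x - z \<in> \<int>" by simp
  qed
qed

instantiation circle :: ab_group_add
begin

lift_definition zero_circle :: circle is 0 .

lift_definition plus_circle :: "circle \<Rightarrow> circle \<Rightarrow> circle" is "(+)"
proof -
  fix a b c d :: real
  assume "a - b \<in> \<int>" "c - d \<in> \<int>"
  then have "(a - b) + (c - d) \<in> \<int>" by (rule Ints_add)
  then show "(a + c) - (b + d) \<in> \<int>" by (simp add: algebra_simps)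
qed

lift_definition uminus_circle :: "circle \<Rightarrow> circle" is uminus
proof -
  fix a b :: real
  assume "a - b \<in> \<int>"
  then have "- (a - b) \<in> \<int>" by (rule Ints_minus)
  then show "- a - - b \<in> \<int>" by simp
qed

lift_definition minus_circle :: "circle \<Rightarrow> circle \<Rightarrow> circle" is "(-)"
proof -
  fix a b c d :: real
  assume "a - b \<in> \<int>" "c - d \<in> \<int>"
  then have "(a - b) - (c - d) \<in> \<int>" by (rule Ints_diff)
  then show "(a - c) - (b - d) \<in> \<int>" by (simp add: algebra_simps)
qed

instance
  by (standard; transfer; simp)

end

lemma to_circle_eq_iff: "to_circle x = to_circle y \<longleftrightarrow> x - y \<in> \<int>"
  by (rule circle.abs_eq_iff)

lemma to_circle_surj: "\<exists>x. p = to_circle x"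
  by (induction p rule: circle.abs_induct) blast

lemma to_circle_frac [simp]: "to_circle (frac x) = to_circle x"
  by (simp add: to_circle_eq_iff frac_def)

text \<open>The metric is the usual one, induced by the distance to the nearest integer.\<close>

instantiation circle :: metric_space
begin

lift_definition dist_circle :: "circle \<Rightarrow> circle \<Rightarrow> real"
  is "\<lambda>x y. \<bar>(x - y) - of_int (round (x - y))\<bar>"
proof -
  have le: "\<bar>u - of_int (round u)\<bar> \<le> \<bar>v - of_int (round v)\<bar>" if uv: "u - v \<in> \<int>" for u v :: real
  proof -
    obtain k where k: "u - v = of_int k" using uv by (rule Ints_cases)
    have "\<bar>u - of_int (round u)\<bar> \<le> \<bar>u - of_int (round v + k)\<bar>"
      by (rule round_diff_minimal)
    also have "u - of_int (round v + k) = v - of_int (round v)"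
      using k by simp
    finally show ?thesis .
  qed
  fix a b c d :: real
  assume "a - b \<in> \<int>" "c - d \<in> \<int>"
  then have "(a - b) - (c - d) \<in> \<int>" "(c - d) - (a - b) \<in> \<int>" by (auto intro: Ints_diff)
  then have "(a - c) - (b - d) \<in> \<int>" "(b - d) - (a - c) \<in> \<int>" by (simp_all add: algebra_simps)
  then show "\<bar>(a - c) - of_int (round (a - c))\<bar> = \<bar>(b - d) - of_int (round (b - d))\<bar>"
    by (intro antisym le)
qed

definition uniformity_circle :: "(circle \<times> circle) filter" where
  "uniformity_circle = (INF e\<in>{0 <..}. principal {(x, y). dist x y < e})"

definition open_circle :: "circle set \<Rightarrow> bool" where
  "open_circle U \<longleftrightarrow> (\<forall>x\<in>U. eventually (\<lambda>(x', y). x' = x \<longrightarrow> y \<in> U) uniformity)"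

instance
proof
  show "uniformity = (INF e\<in>{0 <..}. principal {(x, y::circle). dist x y < e})"
    by (rule uniformity_circle_def)
  show "open U \<longleftrightarrow> (\<forall>x\<in>U. eventually (\<lambda>(x', y). x' = x \<longrightarrow> y \<in> U) uniformity)"
    for U :: "circle set"
    by (rule open_circle_def)
  show "dist x y = 0 \<longleftrightarrow> x = y" for x y :: circle
    by transfer (auto elim!: Ints_cases, metis Ints_of_int)
  show "dist x y \<le> dist x z + dist y z" for x y z :: circle
  proof transfer
    fix x y z :: real
    have "\<bar>(x - y) - of_int (round (x - y))\<bar>
        \<le> \<bar>(x - y) - of_int (round (x - z) - round (y - z))\<bar>"
      by (rule round_diff_minimal)
    then show "\<bar>(x - y) - of_int (round (x - y))\<bar>
        \<le> \<bar>(x - z) - of_int (round (x - z))\<bar> + \<bar>(y - z) - of_int (round (y - z))\<bar>"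
      by simp
  qed
qed

end

text \<open>The topology of this metric is the quotient topology, and the circle is compact.\<close>

lemma dist_to_circle_le: "dist (to_circle x) (to_circle y) \<le> dist x y"
  unfolding dist_circle.abs_eq dist_real_def using round_diff_minimal[of "x - y" 0] by simp

lemma continuous_on_to_circle: "continuous_on S to_circle"
  unfolding continuous_on_iff by (meson dist_to_circle_le le_less_trans)

lemma open_circle_iff_vimage: "open U \<longleftrightarrow> open (to_circle -` U)"
proof
  show "open (to_circle -` U)" if "open U"
    using that by (simp add: continuous_on_to_circle open_vimage)
  assume o: "open (to_circle -` U)"
  show "open U"
    unfolding open_dist
  proof
    fix p assume "p \<in> U"
    obtain x where x: "p = to_circle x" using to_circle_surj by blast
    with o \<open>p \<in> U\<close> obtain e where e: "e > 0" "\<And>y. dist y x < e \<Longrightarrow> to_circle y \<in> U"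
      by (auto simp: open_dist)
    have "q \<in> U" if "dist q p < e" for q
    proof -
      obtain y where y: "q = to_circle y" using to_circle_surj by blast
      have "to_circle (y - of_int (round (y - x))) \<in> U"
        using that by (intro e) (simp add: x y dist_circle.abs_eq dist_real_def algebra_simps)
      moreover have "to_circle (y - of_int (round (y - x))) = q"
        by (simp add: y to_circle_eq_iff)
      ultimately show ?thesis by simp
    qed
    with e(1) show "\<exists>e>0. \<forall>q. dist q p < e \<longrightarrow> q \<in> U" by blast
  qed
qed

lemma compact_UNIV_circle: "compact (UNIV :: circle set)"
proof -
  have "p \<in> to_circle ` {0..1}" for p
  proof -
    obtain x where "p = to_circle x" using to_circle_surj by blast
    then have "p = to_circle (frac x)" by simp
    moreover have "frac x \<in> {0..1}" by (simp add: frac_lt_1 less_imp_le)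
    ultimately show ?thesis by blast
  qed
  then have "to_circle ` {0..1} = UNIV" by blast
  then show ?thesis
    using compact_continuous_image[OF continuous_on_to_circle compact_Icc, of 0 1] by simp
qed

section \<open>Lower box-counting dimension\<close>

text \<open>
  The least number of sets of diameter at most \<open>\<delta>\<close> needed to cover \<open>K\<close>. It is meaningful for
  totally bounded \<open>K\<close>, hence for every subset of the circle. The boundedness condition is
  needed because \<^const>\<open>diameter\<close> is unspecified on unbounded sets.
\<close>

definition covering_number :: "'a::metric_space set \<Rightarrow> real \<Rightarrow> nat" where
  "covering_number K \<delta> =
    (LEAST n. \<exists>\<U>. finite \<U> \<and> card \<U> = n \<and> K \<subseteq> \<Union>\<U> \<and> (\<forall>U\<in>\<U>. bounded U \<and> diameter U \<le> \<delta>))"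

definition lower_box_dim :: "'a::metric_space set \<Rightarrow> ereal" where
  "lower_box_dim K = Liminf (at_right 0) (\<lambda>\<delta>. ereal (ln (real (covering_number K \<delta>)) / - ln \<delta>))"

section \<open>Sets and independence associated with \<open>\<alpha>\<^sub>1, \<dots>, \<alpha>\<^sub>l\<close>\<close>

text \<open>Tuples \<open>(\<alpha>\<^sub>1, \<dots>, \<alpha>\<^sub>l)\<close> are functions on \<^typ>\<open>nat\<close> of which only the values on
  \<open>{1..l}\<close> are used.\<close>

definition alpha_set :: "nat \<Rightarrow> (nat \<Rightarrow> real) \<Rightarrow> circle set \<Rightarrow> bool" where
  "alpha_set l \<alpha> K \<longleftrightarrow>
    K \<noteq> {} \<and> closed K \<and> K \<subseteq> (\<Union>i\<in>{1..l}. (\<lambda>x. x - to_circle (\<alpha> i)) ` K)"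

lemma alpha_set_iff:
  "alpha_set l \<alpha> K \<longleftrightarrow>
    K \<noteq> {} \<and> closed K \<and> (\<forall>x\<in>K. \<exists>i\<in>{1..l}. x + to_circle (\<alpha> i) \<in> K)"
proof -
  have "x \<in> (\<lambda>x. x - to_circle (\<alpha> i)) ` K \<longleftrightarrow> x + to_circle (\<alpha> i) \<in> K" for x i
  proof
    assume "x + to_circle (\<alpha> i) \<in> K"
    then have "(x + to_circle (\<alpha> i)) - to_circle (\<alpha> i) \<in> (\<lambda>x. x - to_circle (\<alpha> i)) ` K"
      by (rule imageI)
    then show "x \<in> (\<lambda>x. x - to_circle (\<alpha> i)) ` K" by simp
  qed auto
  then show ?thesis
    unfolding alpha_set_def subset_eq UN_iff by (simp only:)
qed

definition nonneg_rat_independent_mod1 :: "nat \<Rightarrow> (nat \<Rightarrow> real) \<Rightarrow> bool" where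
  "nonneg_rat_independent_mod1 l \<alpha> \<longleftrightarrow>
    (\<forall>t :: nat \<Rightarrow> rat. (\<forall>i\<in>{1..l}. t i \<ge> 0) \<and> (\<Sum>i=1..l. of_rat (t i) * \<alpha> i) \<in> \<int>
      \<longrightarrow> (\<forall>i\<in>{1..l}. t i = 0))"

global_interpretation rat_real: vector_space "\<lambda>(q::rat) (x::real). of_rat q * x"
  by standard (simp_all add: algebra_simps of_rat_add of_rat_mult)

text \<open>The truncated subtraction is harmless, since the span contains 1 and is finite-dimensional.\<close>

definition rat_rank :: "nat \<Rightarrow> (nat \<Rightarrow> real) \<Rightarrow> nat" where
  "rat_rank l \<alpha> = rat_real.dim (rat_real.span (insert 1 (\<alpha> ` {1..l}))) - 1"

definition difference_set :: "'a::minus set \<Rightarrow> 'a set" where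
  "difference_set K = {x - y | x y. x \<in> K \<and> y \<in> K}"

end

theory Submission
  imports Defs
begin

text \<open>
  Three arguments are combined.

  \<^emph>\<open>The bound \<open>1 / (r + 1)\<close>\<close> (\<open>lower_box_dim_rank\<close>). Lift \<open>K\<close> to \<open>[0, 1)\<close> and cut this interval into cells
  of length \<open>2 ^ - n\<close>, of which the lift meets \<open>N\<close>. A step leads from \<open>p\<close> to some \<open>q\<close> in the lift with \<open>q - p\<close>
  in some \<open>\<alpha>\<^sub>i + \<int>\<close>. Steps are concatenated to closed chains if each starts in the cell where the
  previous one ended. The sum \<open>w\<close> of the increments of a closed chain is nonzero by independence. It is also
  small, at most \<open>length / 2 ^ n\<close>, as only the jumps inside the cells contribute. A closed chain which
  repeats a cell splits into shorter ones, so the rational span \<open>U\<^sub>n\<close> of all these sums is generated by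
  chains of length at most \<open>N\<close>. The spaces \<open>U\<^sub>n\<close> decrease with \<open>n\<close> inside \<open>span(1, \<alpha>\<^sub>1, \<dots>, \<alpha>\<^sub>l)\<close>; hence their
  dimension is finally constant, say \<open>s\<close> with \<open>1 \<le> s \<le> r + 1\<close>. In a basis that does not depend on \<open>n\<close>, the \<open>s\<close> independent
  sums have coordinates of size \<open>O(N)\<close> with bounded denominators, so elimination by Siegel's lemma
  leaves a nonzero number, bounded away from \<open>0\<close>, that is a combination of the sums with integer
  coefficients of size \<open>O(N ^ (s - 1))\<close>. Since each sum is at most \<open>N / 2 ^ n\<close>, this forces \<open>N ^ s \<ge> C * 2 ^ n\<close>.

  \<^emph>\<open>Rank one\<close> (\<open>interior_rank_one\<close>). Here \<open>\<alpha>\<^sub>i = p\<^sub>i \<gamma> + q\<^sub>i\<close> with rational \<open>p\<^sub>i\<close> and \<open>q\<^sub>i\<close>, and independence says that the \<open>p\<^sub>i\<close>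
  are nonzero of equal sign. An orbit thus moves along the multiples of a single irrational number
  with bounded gaps, finitely many translates of \<open>K\<close> cover the circle, and \<open>K\<close> has interior.

  \<^emph>\<open>Two steps\<close> (\<open>difference_set_or_interior_two\<close>). Count the steps \<open>\<alpha>\<^sub>1\<close> in time windows of length \<open>k\<close> along
  an orbit. If these counts vary by unbounded amounts, \<open>K - K\<close> contains progressions of step
  \<open>\<alpha>\<^sub>1 - \<alpha>\<^sub>2\<close> of any length and is the whole circle. If they vary by a bounded amount, the orbit follows
  a line of some slope \<open>\<theta>\<close>, and finitely many translates of \<open>K\<close> contain the image of a whole strip of lattice
  points around it, which is dense in some arc (\<open>interior_strip\<close>). When \<open>\<alpha>\<^sub>1 - \<alpha>\<^sub>2\<close> is rational, the
  rank-one argument applies. The bound \<open>1 / 2\<close> follows since \<open>K - K\<close> can be covered by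
  differences of the sets in a cover of \<open>K\<close>.
\<close>

section \<open>Translations and closed sets on the circle\<close>

lemma to_circle_add: "to_circle (x + y) = to_circle x + to_circle y"
  by (simp add: plus_circle.abs_eq)

lemma to_circle_diff: "to_circle (x - y) = to_circle x - to_circle y"
  by (simp add: minus_circle.abs_eq)

lemma to_circle_add_int: "k \<in> \<int> \<Longrightarrow> to_circle (x + k) = to_circle x"
  by (simp add: to_circle_eq_iff)

lemma dist_to_circle: "dist (to_circle x) (to_circle y) = \<bar>(x - y) - of_int (round (x - y))\<bar>"
  by (simp add: dist_circle.abs_eq)

lemma dist_to_circle_le_int: "k \<in> \<int> \<Longrightarrow> dist (to_circle x) (to_circle y) \<le> \<bar>x - y - k\<bar>"
  by (metis Ints_cases dist_to_circle round_diff_minimal)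

lemma dist_circle_translate: "dist (p + c) (q + c) = dist p (q::circle)"
proof -
  obtain x y z where "p = to_circle x" "q = to_circle y" "c = to_circle z"
    using to_circle_surj by metis
  then show ?thesis
    by (simp flip: to_circle_add add: dist_to_circle)
qed

lemma dist_circle_add_le: "dist (p + p') (q + q') \<le> dist p q + dist p' (q'::circle)"
proof -
  have "dist (p + p') (q + q') \<le> dist (p + p') (q + p') + dist (q + p') (q + q')"
    by (rule dist_triangle)
  also have "dist (q + p') (q + q') = dist p' q'"
    using dist_circle_translate[of p' q q'] by (simp add: add.commute)
  finally show ?thesis by (simp add: dist_circle_translate)
qed

lemma dist_circle_minus: "dist (- p) (- q) = dist p (q::circle)"
proof -
  have "dist (- p) (- q) = dist (- p + (p + q)) (- q + (p + q))"
    by (rule dist_circle_translate[symmetric])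
  also have "\<dots> = dist p q" by (simp add: dist_commute)
  finally show ?thesis .
qed

lemma dist_circle_diff_le: "dist (p - p') (q - q') \<le> dist p q + dist p' (q'::circle)"
  using dist_circle_add_le[of p "- p'" q "- q'"] by (simp add: dist_circle_minus)

lemma near_to_circle:
  assumes "dist p (to_circle x) < \<rho>"
  obtains t where "\<bar>t\<bar> < \<rho>" "p = to_circle (x + t)"
proof -
  obtain y where y: "p = to_circle y" using to_circle_surj by blast
  define t where "t = (y - x) - of_int (round (y - x))"
  have "p = to_circle (x + t)"
    by (simp add: y t_def to_circle_eq_iff)
  moreover have "\<bar>t\<bar> < \<rho>"
    using assms by (simp add: y t_def dist_to_circle)
  ultimately show thesis using that by blast
qed

lemma vimage_translate_circle: "(\<lambda>p. p + c) ` S = (\<lambda>p. p - c) -` (S::circle set)"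
  by (auto simp: image_iff) (metis diff_add_cancel)

lemma continuous_circle_diff: "continuous_on S (\<lambda>p. p - (c::circle))"
  unfolding continuous_on_iff
  by (metis dist_circle_translate diff_conv_add_uminus)

lemma closed_circle_translate: "closed S \<Longrightarrow> closed ((\<lambda>p. p + (c::circle)) ` S)"
  unfolding vimage_translate_circle
  using continuous_circle_diff[of UNIV c] by (simp add: closed_vimage)

lemma interior_circle_translate:
  assumes "interior ((\<lambda>p. p + (c::circle)) ` S) \<noteq> {}"
  shows "interior S \<noteq> {}"
proof -
  obtain p e where "e > 0" and e: "ball p e \<subseteq> (\<lambda>p. p + c) ` S"
    using assms by (auto simp: mem_interior)
  have "ball (p - c) e \<subseteq> S"
  proof
    fix q assume "q \<in> ball (p - c) e"
    then have "q + c \<in> ball p e"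
      using dist_circle_translate[of "p - c" c q] by simp
    with e show "q \<in> S" by (auto simp: image_iff)
  qed
  with \<open>e > 0\<close> show ?thesis by (metis interior_maximal open_ball centre_in_ball subsetD empty_iff)
qed

text \<open>A finite union of closed sets without interior has no interior. So as soon as finitely many
  translates of \<open>K\<close> fill an arc, \<open>K\<close> itself contains an arc.\<close>

lemma interior_finite_translates:
  assumes "finite F" "closed (K::circle set)" "interior (\<Union>c\<in>F. (\<lambda>p. p + c) ` K) \<noteq> {}"
  shows "interior K \<noteq> {}"
  using assms(1,3)
proof (induction F rule: finite_induct)
  case (insert c F)
  show ?case
  proof (cases "interior ((\<lambda>p. p + c) ` K) = {}")
    case True
    have "closed (\<Union>c\<in>F. (\<lambda>p. p + c) ` K)"
      using insert.hyps assms(2) closed_circle_translate by blast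
    from interior_closed_Un_empty_interior[OF this True] insert show ?thesis
      by (simp add: Un_commute)
  next
    case False
    then show ?thesis by (rule interior_circle_translate)
  qed
qed simp

lemma closed_difference_set:
  assumes "closed (K::circle set)"
  shows "closed (difference_set K)"
proof -
  have "compact K"
    using compact_UNIV_circle assms by (metis compact_Int_closed inf_top_left)
  have "continuous_on (K \<times> K) (\<lambda>z. fst z - snd z)"
    unfolding continuous_on_iff
  proof (intro ballI allI impI)
    fix z :: "circle \<times> circle" and e :: real assume "e > 0"
    have "dist (fst z' - snd z') (fst z - snd z) < e" if "dist z' z < e / 2" for z'
    proof -
      have "dist (fst z' - snd z') (fst z - snd z) \<le> dist (fst z') (fst z) + dist (snd z') (snd z)"
        by (rule dist_circle_diff_le)
      also have "\<dots> \<le> dist z' z + dist z' z"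
        by (intro add_mono dist_fst_le dist_snd_le)
      finally show ?thesis using that by simp
    qed
    with \<open>e > 0\<close> show "\<exists>d>0. \<forall>z'\<in>K \<times> K. dist z' z < d \<longrightarrow> dist (fst z' - snd z') (fst z - snd z) < e"
      by (intro exI[of _ "e/2"]) auto
  qed
  then have "compact ((\<lambda>z. fst z - snd z) ` (K \<times> K))"
    using \<open>compact K\<close> by (intro compact_continuous_image compact_Times)
  moreover have "(\<lambda>z. fst z - snd z) ` (K \<times> K) = difference_set K"
    unfolding difference_set_def by force
  ultimately show ?thesis by (simp add: compact_imp_closed)
qed

lemma closed_circle_eq_UNIV:
  assumes "closed (S::circle set)"
    and dense: "\<And>y e. e > 0 \<Longrightarrow> \<exists>z. to_circle z \<in> S \<and> (\<exists>k\<in>\<int>. \<bar>z - y - k\<bar> < e)"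
  shows "S = UNIV"
proof -
  have "p \<in> closure S" for p
    unfolding closure_approachable
  proof (intro allI impI)
    fix e :: real assume "e > 0"
    obtain y where y: "p = to_circle y" using to_circle_surj by blast
    obtain z k where "to_circle z \<in> S" "k \<in> \<int>" "\<bar>z - y - k\<bar> < e"
      using dense[OF \<open>e > 0\<close>] by blast
    then show "\<exists>q\<in>S. dist q p < e"
      using dist_to_circle_le_int[of k z y] y by force
  qed
  with assms(1) show ?thesis by auto
qed

lemma interior_circle_arc:
  assumes "a < b" "\<And>y. a < y \<Longrightarrow> y < b \<Longrightarrow> to_circle y \<in> S"
  shows "interior S \<noteq> {}"
proof -
  define m where "m = (a + b) / 2"
  have "ball (to_circle m) ((b - a) / 2) \<subseteq> S"
  proof
    fix p assume "p \<in> ball (to_circle m) ((b - a) / 2)"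
    then obtain t where "\<bar>t\<bar> < (b - a) / 2" "p = to_circle (m + t)"
      by (metis dist_commute mem_ball near_to_circle)
    then show "p \<in> S"
      by (auto simp: m_def abs_less_iff field_simps intro!: assms(2))
  qed
  with \<open>a < b\<close> show ?thesis
    by (metis centre_in_ball diff_gt_0_iff_gt empty_iff half_gt_zero interior_maximal open_ball subsetD)
qed

section \<open>Covering numbers\<close>

lemma diameter_le_dist:
  fixes S :: "'a::metric_space set"
  assumes "0 \<le> \<delta>" "\<And>x y. x \<in> S \<Longrightarrow> y \<in> S \<Longrightarrow> dist x y \<le> \<delta>"
  shows "diameter S \<le> \<delta>"
  using assms by (auto simp: diameter_def intro: cSUP_least)

lemma covering_number_attained:
  assumes "\<delta> > 0"
  obtains \<U> where "finite \<U>" "card \<U> = covering_number (K::circle set) \<delta>" "K \<subseteq> \<Union>\<U>"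
    "\<And>U. U \<in> \<U> \<Longrightarrow> bounded U \<and> diameter U \<le> \<delta>"
proof -
  let ?P = "\<lambda>n \<U>. finite \<U> \<and> card \<U> = n \<and> K \<subseteq> \<Union>\<U> \<and> (\<forall>U\<in>\<U>. bounded U \<and> diameter U \<le> \<delta>)"
  obtain k where k: "finite k" "UNIV \<subseteq> (\<Union>x\<in>k. ball (x::circle) (\<delta> / 2))"
    using compact_UNIV_circle assms unfolding compact_eq_totally_bounded by (meson half_gt_zero)
  have "diameter (ball x (\<delta> / 2)) \<le> \<delta>" for x :: circle
  proof (rule diameter_le_dist)
    fix p q assume "p \<in> ball x (\<delta> / 2)" "q \<in> ball x (\<delta> / 2)"
    then show "dist p q \<le> \<delta>"
      using dist_triangle3[of p q x] by simp
  qed (use assms in simp)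
  then have "?P (card ((\<lambda>x. ball x (\<delta> / 2)) ` k)) ((\<lambda>x. ball x (\<delta> / 2)) ` k)"
    using k by auto
  then have "\<exists>\<U>. ?P (covering_number K \<delta>) \<U>"
    unfolding covering_number_def by (rule LeastI[of "\<lambda>n. \<exists>\<U>. ?P n \<U>", OF exI])
  with that show thesis by blast
qed

lemma covering_number_le:
  assumes "finite \<U>" "K \<subseteq> \<Union>\<U>" "\<And>U. U \<in> \<U> \<Longrightarrow> bounded U \<and> diameter U \<le> \<delta>"
  shows "covering_number K \<delta> \<le> card \<U>"
  unfolding covering_number_def using assms by (intro Least_le) blast

text \<open>A set of diameter at most \<open>\<delta>\<close> contains at most one point of a \<open>\<delta>\<close>-separated set.\<close>

lemma separated_le_covering_number:
  fixes S K :: "circle set"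
  assumes "\<delta> > 0" "S \<subseteq> K" "finite S"
    and sep: "\<And>p q. p \<in> S \<Longrightarrow> q \<in> S \<Longrightarrow> p \<noteq> q \<Longrightarrow> dist p q > \<delta>"
  shows "card S \<le> covering_number K \<delta>"
proof -
  obtain \<U> where \<U>: "finite \<U>" "card \<U> = covering_number K \<delta>" "K \<subseteq> \<Union>\<U>"
    "\<And>U. U \<in> \<U> \<Longrightarrow> bounded U \<and> diameter U \<le> \<delta>"
    using covering_number_attained[OF \<open>\<delta> > 0\<close>] by metis
  have "\<forall>p\<in>S. \<exists>U. U \<in> \<U> \<and> p \<in> U"
    using \<U>(3) \<open>S \<subseteq> K\<close> by blast
  from bchoice[OF this] obtain u where u: "\<And>p. p \<in> S \<Longrightarrow> u p \<in> \<U> \<and> p \<in> u p"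
    by blast
  have "inj_on u S"
  proof (rule inj_onI, rule ccontr)
    fix p q assume pq: "p \<in> S" "q \<in> S" "u p = u q" "p \<noteq> q"
    then have "dist p q \<le> \<delta>"
      using u \<U>(4) diameter_bounded_bound[of "u p" p q] by fastforce
    with sep pq show False by fastforce
  qed
  then show ?thesis
    using card_inj_on_le[of u S \<U>] u \<U>(1,2) by auto
qed

text \<open>Points of an arc with spacing \<open>2\<delta>\<close> are separated, so a set with interior has covering
  numbers of the largest possible order.\<close>

lemma covering_number_ball:
  assumes "e > 0" "ball (p::circle) e \<subseteq> K"
  shows "\<exists>c>0. \<exists>\<delta>0>0. \<forall>\<delta>. 0 < \<delta> \<longrightarrow> \<delta> < \<delta>0 \<longrightarrow> c / \<delta> \<le> real (covering_number K \<delta>)"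
proof -
  define d where "d = min e (1/2)"
  have d: "d > 0" "d \<le> e" "d \<le> 1/2" using assms by (auto simp: d_def)
  obtain x where x: "p = to_circle x" using to_circle_surj by blast
  have "d / 4 / \<delta> \<le> real (covering_number K \<delta>)" if \<delta>: "0 < \<delta>" "\<delta> < d / 4" for \<delta>
  proof -
    define m where "m = nat \<lfloor>d / (2 * \<delta>)\<rfloor>"
    define f where "f j = to_circle (x + real j * (2 * \<delta>))" for j
    have m: "real m \<le> d / (2 * \<delta>)" "d / (2 * \<delta>) < real m + 1"
      using \<delta> d by (auto simp: m_def)
    have m2: "real m * (2 * \<delta>) \<le> d"
      using m(1) \<delta> by (simp add: field_simps)
    have far: "dist (f i) (f j) > \<delta>" if "i < m" "j < m" "i < j" for i j
    proof -
      define t where "t = (real j - real i) * (2 * \<delta>)"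
      have t1: "2 * \<delta> \<le> t"
        using that \<delta> by (simp add: t_def)
      have "t \<le> real m * (2 * \<delta>)"
        using that \<delta> by (simp add: t_def)
      then have t2: "t \<le> 1/2" using m2 d by linarith
      have "dist (f i) (f j) = \<bar>- t - of_int (round (- t))\<bar>"
        by (simp add: f_def dist_to_circle t_def algebra_simps)
      moreover have "\<bar>- t - of_int k\<bar> > \<delta>" for k :: int
      proof (cases "k = 0")
        case False
        show ?thesis
        proof (cases "k \<le> -1")
          case True
          then have "real_of_int k \<le> -1" by linarith
          then show ?thesis using t1 t2 \<delta> d by linarith
        next
          case False
          then have "real_of_int k \<ge> 1" using \<open>k \<noteq> 0\<close> by linarith
          then show ?thesis using t1 t2 \<delta> d by linarith
        qed
      qed (use t1 \<delta> in linarith)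
      ultimately show ?thesis by simp
    qed
    have far': "dist (f i) (f j) > \<delta>" if "i < m" "j < m" "i \<noteq> j" for i j
      using far[of i j] far[of j i] that by (metis dist_commute linorder_neqE_nat)
    have "inj_on f {..<m}"
      using far' \<delta>(1) by (force simp: inj_on_def)
    then have "card (f ` {..<m}) = m" by (simp add: card_image)
    moreover have "card (f ` {..<m}) \<le> covering_number K \<delta>"
    proof (rule separated_le_covering_number[OF \<delta>(1)])
      show "f ` {..<m} \<subseteq> K"
      proof
        fix q assume "q \<in> f ` {..<m}"
        then obtain j where j: "j < m" "q = f j" by blast
        have "dist p q \<le> real j * (2 * \<delta>)"
          using dist_to_circle_le_int[of 0 x "x + real j * (2 * \<delta>)"] \<delta> j(2) by (simp add: x f_def)
        also have "\<dots> < real m * (2 * \<delta>)" using j \<delta> by simp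
        finally show "q \<in> K" using m2 d assms(2) by auto
      qed
    qed (use far' in auto)
    ultimately have "m \<le> covering_number K \<delta>" by simp
    moreover have "d / 4 / \<delta> \<le> real m"
    proof -
      have "1 \<le> d / (4 * \<delta>)" using \<delta> by simp
      then show ?thesis using m(2) by (simp add: field_simps)
    qed
    ultimately show ?thesis by (meson dual_order.trans of_nat_mono)
  qed
  then show ?thesis
    using d(1) by (intro exI[of _ "d/4"] conjI) auto
qed

text \<open>Differences of covering sets cover the difference set at twice the scale.\<close>

lemma covering_number_difference_set:
  assumes "\<delta> > 0"
  shows "covering_number (difference_set (K::circle set)) (2 * \<delta>) \<le> (covering_number K \<delta>)\<^sup>2"
proof -
  obtain \<U> where \<U>: "finite \<U>" "card \<U> = covering_number K \<delta>" "K \<subseteq> \<Union>\<U>"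
    "\<And>U. U \<in> \<U> \<Longrightarrow> bounded U \<and> diameter U \<le> \<delta>"
    using covering_number_attained[OF assms] by metis
  define D where "D = (\<lambda>(U, V). {x - y | x y. x \<in> U \<and> y \<in> V}) ` (\<U> \<times> \<U> :: (circle set \<times> circle set) set)"
  have "covering_number (difference_set K) (2 * \<delta>) \<le> card D"
  proof (rule covering_number_le)
    show "finite D" using \<U>(1) by (simp add: D_def)
    show "difference_set K \<subseteq> \<Union>D"
    proof
      fix z assume "z \<in> difference_set K"
      then obtain x y where "x \<in> K" "y \<in> K" "z = x - y" by (auto simp: difference_set_def)
      moreover obtain U V where "U \<in> \<U>" "V \<in> \<U>" "x \<in> U" "y \<in> V"
        using \<U>(3) \<open>x \<in> K\<close> \<open>y \<in> K\<close> by blast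
      ultimately show "z \<in> \<Union>D" by (force simp: D_def)
    qed
    fix W assume "W \<in> D"
    then obtain U V where UV: "U \<in> \<U>" "V \<in> \<U>" "W = {x - y | x y. x \<in> U \<and> y \<in> V}"
      by (auto simp: D_def)
    have *: "dist z z' \<le> 2 * \<delta>" if zz: "z \<in> W" "z' \<in> W" for z z'
    proof -
      obtain x y x' y' where **: "x \<in> U" "y \<in> V" "x' \<in> U" "y' \<in> V" "z = x - y" "z' = x' - y'"
        using zz UV(3) by blast
      have "dist x x' \<le> diameter U" "dist y y' \<le> diameter V"
        using ** UV \<U>(4) by (auto intro!: diameter_bounded_bound)
      with UV \<U>(4) have "dist x x' \<le> \<delta>" "dist y y' \<le> \<delta>" by force+
      then show ?thesis using dist_circle_diff_le[of x y x' y'] ** by simp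
    qed
    show "bounded W \<and> diameter W \<le> 2 * \<delta>"
    proof
      show "bounded W"
        using * unfolding bounded_two_points by blast
      show "diameter W \<le> 2 * \<delta>"
        using assms by (intro diameter_le_dist *) auto
    qed
  qed
  also have "card D \<le> card (\<U> \<times> \<U>)"
    unfolding D_def using \<U>(1) by (intro card_image_le) simp
  also have "\<dots> = (covering_number K \<delta>)\<^sup>2"
    by (simp add: \<U>(2) power2_eq_square card_cartesian_product)
  finally show ?thesis .
qed

text \<open>The constant \<open>c\<close> disappears in the limit, because its contribution \<open>ln c / - ln \<delta>\<close> tends to \<open>0\<close>.\<close>

lemma lower_box_dim_ge:
  assumes "s > 0" "c > 0" "\<delta>0 > 0"
    and bound: "\<And>\<delta>. 0 < \<delta> \<Longrightarrow> \<delta> < \<delta>0 \<Longrightarrow> c / \<delta> \<le> real (covering_number K \<delta>) ^ s"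
  shows "lower_box_dim K \<ge> ereal (1 / real s)"
proof -
  define g where "g \<delta> = 1 / real s * (1 + ln c / - ln \<delta>)" for \<delta>
  have "filterlim (\<lambda>\<delta>::real. - ln \<delta>) at_top (at_right 0)"
    using ln_at_0 by (simp add: filterlim_uminus_at_top)
  then have "((\<lambda>\<delta>. ln c / - ln \<delta>) \<longlongrightarrow> 0) (at_right 0)"
    by (rule real_tendsto_divide_at_top[OF tendsto_const])
  then have "(g \<longlongrightarrow> 1 / real s * (1 + 0)) (at_right 0)"
    unfolding g_def by (intro tendsto_intros)
  then have lim: "((\<lambda>\<delta>. ereal (g \<delta>)) \<longlongrightarrow> ereal (1 / real s)) (at_right 0)"
    by simp
  have "\<forall>\<^sub>F \<delta> in at_right 0. ereal (g \<delta>) \<le> ereal (ln (real (covering_number K \<delta>)) / - ln \<delta>)"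
  proof (rule eventually_at_rightI[of 0 "min \<delta>0 1"])
    fix \<delta> :: real assume "\<delta> \<in> {0<..<min \<delta>0 1}"
    then have \<delta>: "0 < \<delta>" "\<delta> < \<delta>0" "\<delta> < 1" by auto
    let ?N = "real (covering_number K \<delta>)"
    have "0 < c / \<delta>" using assms \<delta> by simp
    have b: "c / \<delta> \<le> ?N ^ s" using bound \<delta> by blast
    with \<open>0 < c / \<delta>\<close> have "?N ^ s > 0" by linarith
    then have "?N > 0" using assms(1) by (metis of_nat_0_le_iff less_eq_real_def zero_power less_irrefl)
    have "ln (c / \<delta>) \<le> ln (?N ^ s)" using b \<open>0 < c / \<delta>\<close> \<open>?N ^ s > 0\<close> by (intro ln_mono)
    then have "ln c - ln \<delta> \<le> real s * ln ?N"
      using \<open>?N > 0\<close> \<delta> assms by (simp add: ln_div ln_realpow)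
    then have "(ln c - ln \<delta>) / (real s * - ln \<delta>) \<le> real s * ln ?N / (real s * - ln \<delta>)"
      using \<delta> assms(1) by (intro divide_right_mono) (auto simp: mult_le_0_iff)
    moreover have "(ln c - ln \<delta>) / (real s * - ln \<delta>) = g \<delta>"
      using \<delta> assms(1) by (simp add: g_def divide_simps)
    ultimately have "g \<delta> \<le> ln ?N / - ln \<delta>"
      using assms(1) by simp
    then show "ereal (g \<delta>) \<le> ereal (ln ?N / - ln \<delta>)" by simp
  qed (use assms in simp)
  then have "Liminf (at_right 0) (\<lambda>\<delta>. ereal (g \<delta>)) \<le> lower_box_dim K"
    unfolding lower_box_dim_def by (rule Liminf_mono)
  with lim_imp_Liminf[OF _ lim] show ?thesis by simp
qed

lemma lower_box_dim_interior:
  assumes "interior (K::circle set) \<noteq> {}"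
  shows "lower_box_dim K \<ge> 1"
proof -
  obtain p e where "e > 0" "ball p e \<subseteq> K" using assms by (auto simp: mem_interior)
  from covering_number_ball[OF this] obtain c \<delta>0 where "c > 0" "\<delta>0 > 0"
    "\<And>\<delta>. 0 < \<delta> \<Longrightarrow> \<delta> < \<delta>0 \<Longrightarrow> c / \<delta> \<le> real (covering_number K \<delta>)" by blast
  then have "lower_box_dim K \<ge> ereal (1 / real 1)"
    by (intro lower_box_dim_ge[of 1 c \<delta>0]) auto
  then show ?thesis by (simp add: one_ereal_def)
qed

lemma lower_box_dim_difference_set:
  assumes "difference_set (K::circle set) = UNIV"
  shows "lower_box_dim K \<ge> 1 / 2"
proof -
  obtain c \<delta>0 where c: "c > 0" "\<delta>0 > 0"
    "\<And>\<delta>. 0 < \<delta> \<Longrightarrow> \<delta> < \<delta>0 \<Longrightarrow> c / \<delta> \<le> real (covering_number (UNIV::circle set) \<delta>)"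
    using covering_number_ball[of 1 undefined UNIV] by auto
  have "c / 2 / \<delta> \<le> real (covering_number K \<delta>) ^ 2" if "0 < \<delta>" "\<delta> < \<delta>0 / 2" for \<delta>
  proof -
    have "c / (2 * \<delta>) \<le> real (covering_number (UNIV::circle set) (2 * \<delta>))"
      using that by (intro c(3)) auto
    also have "\<dots> \<le> real (covering_number K \<delta>) ^ 2"
      using covering_number_difference_set[of \<delta> K] that assms
      by (simp flip: of_nat_power)
    finally show ?thesis by simp
  qed
  with c have "lower_box_dim K \<ge> ereal (1 / real 2)"
    by (intro lower_box_dim_ge[of 2 "c/2" "\<delta>0/2"]) auto
  moreover have "ereal (1 / real 2) = 1 / 2" by (simp add: one_ereal_def numeral_eq_ereal)
  ultimately show ?thesis by simp
qed

section \<open>Irrational rotations\<close>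

text \<open>Kronecker's theorem for the points of a finite grid gives a bound \<open>J\<close> on the multiples that
  works for all targets at once.\<close>

lemma irrational_multiples_uniformly_dense:
  fixes \<gamma> e :: real
  assumes "\<gamma> \<notin> \<rat>" "e > 0"
  obtains J :: nat where "\<And>y. \<exists>j\<le>J. \<exists>k\<in>\<int>. \<bar>real j * \<gamma> - y - k\<bar> < e"
proof -
  have dense: "\<exists>j::nat. \<exists>k\<in>\<int>. \<bar>real j * \<gamma> - y - k\<bar> < e / 2" for y
  proof -
    have "e / 2 > 0" using assms(2) by simp
    then obtain h k where "k > 0" "\<bar>of_int k * \<gamma> - of_int h - y\<bar> < e / 2"
      by (rule sequence_of_fractional_parts_is_dense[OF assms(1)])
    then show ?thesis
      by (intro exI[of _ "nat k"] bexI[of _ "of_int h"]) (auto simp: algebra_simps)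
  qed
  obtain M :: nat where M: "M > 0" "1 / real M < e / 2"
    using real_arch_inverse[of "e / 2"] assms(2) by (auto simp: inverse_eq_divide)
  have "\<forall>i. \<exists>j::nat. \<exists>k\<in>\<int>. \<bar>real j * \<gamma> - real i / real M - k\<bar> < e / 2"
    using dense by blast
  from choice[OF this] obtain J where J: "\<And>i. \<exists>k\<in>\<int>. \<bar>real (J i) * \<gamma> - real i / real M - k\<bar> < e / 2"
    by blast
  have "\<exists>j\<le>Max (J ` {..<M}). \<exists>k\<in>\<int>. \<bar>real j * \<gamma> - y - k\<bar> < e" for y
  proof -
    define i where "i = nat \<lfloor>frac y * real M\<rfloor>"
    have i: "real i \<le> frac y * real M" "frac y * real M < real i + 1"
      by (auto simp: i_def)
    have "frac y * real M < real M" using M(1) by (simp add: frac_lt_1)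
    with i have "i < M" by linarith
    have "real i / real M \<le> frac y" "frac y < real i / real M + 1 / real M"
      using i M(1) by (simp_all add: field_simps)
    then have close: "\<bar>frac y - real i / real M\<bar> < e / 2" using M(2) by linarith
    obtain k where k: "k \<in> \<int>" "\<bar>real (J i) * \<gamma> - real i / real M - k\<bar> < e / 2" using J by blast
    have "real (J i) * \<gamma> - y - (k - of_int \<lfloor>y\<rfloor>)
        = (real (J i) * \<gamma> - real i / real M - k) - (frac y - real i / real M)"
      by (simp add: frac_def)
    then have "\<bar>real (J i) * \<gamma> - y - (k - of_int \<lfloor>y\<rfloor>)\<bar> < e"
      using close k(2) by linarith
    moreover have "k - of_int \<lfloor>y\<rfloor> \<in> \<int>" using k(1) by simp
    ultimately show ?thesis
      using \<open>i < M\<close> by (intro exI[of _ "J i"]) auto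
  qed
  with that show thesis by blast
qed

section \<open>Orbits inside an \<open>(\<alpha>\<^sub>1, \<dots>, \<alpha>\<^sub>l)\<close>-set\<close>

lemma alpha_set_orbit:
  assumes "alpha_set l \<alpha> K"
  obtains i :: "nat \<Rightarrow> nat" and \<xi> :: real
  where "\<And>n. i n \<in> {1..l}" "\<And>n. to_circle (\<xi> + (\<Sum>m<n. \<alpha> (i m))) \<in> K"
proof -
  have K: "K \<noteq> {}" "\<forall>x\<in>K. \<exists>i\<in>{1..l}. x + to_circle (\<alpha> i) \<in> K"
    using assms by (auto simp: alpha_set_iff)
  from K(2) have "\<forall>x\<in>K. \<exists>i. i \<in> {1..l} \<and> x + to_circle (\<alpha> i) \<in> K" by blast
  from bchoice[OF this] obtain s where
    s: "\<And>x. x \<in> K \<Longrightarrow> s x \<in> {1..l}" "\<And>x. x \<in> K \<Longrightarrow> x + to_circle (\<alpha> (s x)) \<in> K"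
    by blast
  obtain \<xi> where "to_circle \<xi> \<in> K" using K(1) to_circle_surj by (metis ex_in_conv)
  define x where "x n = ((\<lambda>x. x + to_circle (\<alpha> (s x))) ^^ n) (to_circle \<xi>)" for n
  have xK: "x n \<in> K" for n
    by (induction n) (use \<open>to_circle \<xi> \<in> K\<close> s in \<open>auto simp: x_def\<close>)
  have "x n = to_circle (\<xi> + (\<Sum>m<n. \<alpha> (s (x m))))" for n
  proof (induction n)
    case (Suc n)
    have "x (Suc n) = x n + to_circle (\<alpha> (s (x n)))" by (simp add: x_def)
    then show ?case using Suc by (simp add: to_circle_add add.assoc)
  qed (simp add: x_def)
  with xK have "to_circle (\<xi> + (\<Sum>m<n. \<alpha> (s (x m)))) \<in> K" for n by metis
  with that[of "\<lambda>n. s (x n)" \<xi>] xK s(1) show thesis by blast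
qed

lemma common_denominator:
  assumes "finite (A :: rat set)"
  obtains D :: nat where "D > 0" "\<And>a. a \<in> A \<Longrightarrow> of_nat D * a \<in> \<int>"
proof -
  have "\<exists>D::nat. D > 0 \<and> (\<forall>a\<in>A. of_nat D * a \<in> \<int>)"
    using assms
  proof (induction A rule: finite_induct)
    case (insert a A)
    then obtain D :: nat where D: "D > 0" "\<forall>a\<in>A. of_nat D * a \<in> \<int>" by blast
    obtain u v where uv: "a = of_int u / of_int v" "v > 0" by (cases a) (auto simp: Fract_of_int_quotient)
    have *: "of_nat (D * nat v) * b \<in> \<int>" if "b \<in> insert a A" for b
    proof (cases "b = a")
      case True
      have "of_nat (D * nat v) * a = (of_int (int D * u) :: rat)"
        using uv by simp
      then show ?thesis using True by (metis Ints_of_int)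
    next
      case False
      have "of_nat (D * nat v) * b = of_int v * (of_nat D * b)"
        using uv by simp
      also have "\<dots> \<in> \<int>" using False that D(2) by (auto intro: Ints_mult simp del: of_int_mult)
      finally show ?thesis .
    qed
    then show ?case using D(1) uv(2) * by (intro exI[of _ "D * nat v"]) auto
  qed (auto intro: exI[of _ 1])
  with that show thesis by blast
qed

text \<open>Clearing denominators, independence modulo \<open>1\<close> is the same as independence modulo the
  rationals.\<close>

lemma nonneg_rat_independent_Rats:
  assumes ind: "nonneg_rat_independent_mod1 l \<alpha>"
    and t: "\<And>i. i \<in> {1..l} \<Longrightarrow> t i \<ge> 0" "(\<Sum>i=1..l. of_rat (t i) * \<alpha> i) \<in> \<rat>" "i \<in> {1..l}"
  shows "t i = 0"
proof -
  obtain q where q: "(\<Sum>i=1..l. of_rat (t i) * \<alpha> i) = of_rat q" using t(2) by (auto elim: Rats_cases)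
  obtain D :: nat where D: "D > 0" "of_nat D * q \<in> \<int>" using common_denominator[of "{q}"] by auto
  have "(\<Sum>i=1..l. of_rat (of_nat D * t i) * \<alpha> i) = of_nat D * (\<Sum>i=1..l. of_rat (t i) * \<alpha> i)"
    by (simp add: sum_distrib_left of_rat_mult algebra_simps)
  also have "\<dots> = of_rat (of_nat D * q)" by (simp only: q of_rat_mult of_rat_of_nat_eq)
  also have "\<dots> \<in> \<int>" using D(2) by (auto elim!: Ints_cases)
  finally have "(\<Sum>i=1..l. of_rat (of_nat D * t i) * \<alpha> i) \<in> \<int>" .
  moreover have "\<forall>i\<in>{1..l}. of_nat D * t i \<ge> 0" using t(1) by simp
  ultimately have "\<forall>i\<in>{1..l}. of_nat D * t i = 0"
    using spec[OF ind[unfolded nonneg_rat_independent_mod1_def], of "\<lambda>i. of_nat D * t i"] by blast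
  with t(3) D(1) show ?thesis by auto
qed

lemma nonneg_rat_independent_irrational:
  assumes "nonneg_rat_independent_mod1 l \<alpha>" "i \<in> {1..l}"
  shows "\<alpha> i \<notin> \<rat>"
proof
  assume "\<alpha> i \<in> \<rat>"
  have "(\<Sum>j=1..l. of_rat (if j = i then 1 else 0) * \<alpha> j) = (\<Sum>j=1..l. if j = i then \<alpha> j else 0)"
    by (intro sum.cong) auto
  also have "\<dots> = \<alpha> i" using assms(2) by simp
  finally show False
    using nonneg_rat_independent_Rats[OF assms(1), of "\<lambda>j. if j = i then 1 else 0" i] assms(2) \<open>\<alpha> i \<in> \<rat>\<close>
    by fastforce
qed

section \<open>Steps in a single direction\<close>

text \<open>If every \<open>\<alpha>\<^sub>i\<close> is a positive rational multiple of one irrational number \<open>\<gamma>\<close> up to a rational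
  shift, an orbit runs, modulo \<open>1 / D\<close>, through the multiples of \<open>\<gamma> / D\<close> with
  increasing factors and bounded gaps, where \<open>D\<close> is a common denominator. Filling the gaps costs
  finitely many translates, so finitely many translates of \<open>K\<close> cover the circle.\<close>

lemma interior_single_direction:
  fixes \<gamma> :: real and p q :: "nat \<Rightarrow> rat"
  assumes K: "alpha_set l \<alpha> K" and \<gamma>: "\<gamma> \<notin> \<rat>"
    and \<alpha>: "\<And>i. i \<in> {1..l} \<Longrightarrow> \<alpha> i = of_rat (p i) * \<gamma> + of_rat (q i)"
    and pos: "\<And>i. i \<in> {1..l} \<Longrightarrow> p i > 0"
  shows "interior K \<noteq> {}"
proof -
  obtain D :: nat where D: "D > 0" "\<And>a. a \<in> p ` {1..l} \<union> q ` {1..l} \<Longrightarrow> of_nat D * a \<in> \<int>"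
    using common_denominator[of "p ` {1..l} \<union> q ` {1..l}"] by auto
  define P where "P i = nat \<lfloor>of_nat D * p i\<rfloor>" for i
  define Q where "Q i = \<lfloor>of_nat D * q i\<rfloor>" for i
  have PQ: "of_nat D * p i = of_nat (P i) \<and> of_nat D * q i = of_int (Q i) \<and> P i > 0"
    if "i \<in> {1..l}" for i
  proof -
    have "of_nat D * p i \<in> \<int>" "of_nat D * q i \<in> \<int>" using D(2) that by auto
    then have uv: "of_nat D * p i = of_int \<lfloor>of_nat D * p i\<rfloor>" "of_nat D * q i = of_int (Q i)"
      unfolding Q_def by (auto elim!: Ints_cases)
    have "of_nat D * p i > 0" using D(1) pos[OF that] by simp
    then have "\<lfloor>of_nat D * p i\<rfloor> > 0" using uv(1) by (metis of_int_0_less_iff)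
    with uv show ?thesis by (simp add: P_def)
  qed
  define \<gamma>' where "\<gamma>' = \<gamma> / real D"
  have \<gamma>': "\<gamma>' \<notin> \<rat>"
  proof
    assume "\<gamma>' \<in> \<rat>"
    then have "real D * \<gamma>' \<in> \<rat>" by (intro Rats_mult) auto
    then show False using \<gamma> D(1) by (simp add: \<gamma>'_def)
  qed
  have \<alpha>': "\<alpha> i = real (P i) * \<gamma>' + of_int (Q i) / real D" if "i \<in> {1..l}" for i
  proof -
    have "p i = of_nat (P i) / of_nat D" "q i = of_int (Q i) / of_nat D"
      using PQ[OF that] D(1) by (simp_all add: field_simps)
    then show ?thesis
      using \<alpha>[OF that] by (simp add: \<gamma>'_def of_rat_divide)
  qed
  obtain i :: "nat \<Rightarrow> nat" and \<xi> where
    orbit: "\<And>n. i n \<in> {1..l}" "\<And>n. to_circle (\<xi> + (\<Sum>m<n. \<alpha> (i m))) \<in> K"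
    using alpha_set_orbit[OF K] by blast
  define s t where "s n = (\<Sum>m<n. P (i m))" and "t n = (\<Sum>m<n. Q (i m))" for n
  have sum_eq: "(\<Sum>m<n. \<alpha> (i m)) = real (s n) * \<gamma>' + of_int (t n) / real D" for n
    by (simp add: s_def t_def \<alpha>'[OF orbit(1)] sum.distrib sum_distrib_right sum_divide_distrib)
  define M where "M = (\<Sum>j=1..l. P j)"
  have step: "s (Suc n) \<le> s n + M" for n
    using member_le_sum[of "i n" "{1..l}" P] orbit(1)[of n] by (simp add: s_def M_def)
  have ge: "n \<le> s n" for n
  proof (induction n)
    case (Suc n)
    have "P (i n) > 0" using PQ orbit(1) by blast
    then show ?case using Suc by (simp add: s_def)
  qed simp
  define F where "F = (\<lambda>(j, k). to_circle (real j * \<gamma>' + real k / real D)) ` ({..M} \<times> {..<D})"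
  define Z where "Z = (\<Union>c\<in>F. (\<lambda>p. p + c) ` K)"
  have "finite F" by (simp add: F_def)
  have mem: "to_circle (\<xi> + real N * \<gamma>') \<in> Z" for N
  proof -
    \<comment> \<open>the last time at which the orbit has not passed the multiple \<open>N\<close>\<close>
    define n where "n = (GREATEST n. s n \<le> N)"
    have ex: "s 0 \<le> N" by (simp add: s_def)
    have bd: "\<forall>n. s n \<le> N \<longrightarrow> n \<le> N" using ge order_trans by blast
    have n1: "s n \<le> N"
      unfolding n_def using GreatestI_nat[of "\<lambda>n. s n \<le> N" 0 N] ex bd by blast
    have "\<not> s (Suc n) \<le> N"
      using Greatest_le_nat[of "\<lambda>n. s n \<le> N" "Suc n" N] bd unfolding n_def by fastforce
    then have n2: "N - s n \<le> M" using step[of n] by linarith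
    define k where "k = nat ((- t n) mod int D)"
    have k: "k < D" using D(1) by (simp add: k_def nat_less_iff)
    obtain h where h: "int k = - t n + int D * h"
    proof
      have "int k = (- t n) mod int D" using D(1) by (simp add: k_def)
      then show "int k = - t n + int D * (- ((- t n) div int D))"
        by (simp add: minus_mult_div_eq_mod)
    qed
    then have hr: "real k = - of_int (t n) + real D * of_int h"
      by (metis of_int_add of_int_minus of_int_mult of_int_of_nat_eq)
    have "\<xi> + real N * \<gamma>' = \<xi> + (real (s n) * \<gamma>' + of_int (t n) / real D)
        + (real (N - s n) * \<gamma>' + real k / real D) + of_int (- h)"
      using D(1) n1 by (simp add: hr of_nat_diff field_simps)
    then have "to_circle (\<xi> + real N * \<gamma>') = to_circle (\<xi> + (\<Sum>m<n. \<alpha> (i m)))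
        + to_circle (real (N - s n) * \<gamma>' + real k / real D)"
      by (simp only: to_circle_add_int[OF Ints_of_int] to_circle_add[symmetric] sum_eq)
    then show ?thesis
      unfolding Z_def F_def using orbit(2)[of n] n2 k by force
  qed
  have "closed Z"
    unfolding Z_def using \<open>finite F\<close> K closed_circle_translate by (auto simp: alpha_set_def)
  have "Z = UNIV"
  proof (rule closed_circle_eq_UNIV[OF \<open>closed Z\<close>])
    fix y e :: real assume "e > 0"
    obtain J where "\<And>y. \<exists>j\<le>J. \<exists>k\<in>\<int>. \<bar>real j * \<gamma>' - y - k\<bar> < e"
      using irrational_multiples_uniformly_dense[OF \<gamma>' \<open>e > 0\<close>] by blast
    then obtain j k where jk: "k \<in> \<int>" "\<bar>real j * \<gamma>' - (y - \<xi>) - k\<bar> < e" by blast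
    have "to_circle (\<xi> + real j * \<gamma>') \<in> Z" by (rule mem)
    moreover have "\<bar>\<xi> + real j * \<gamma>' - y - k\<bar> < e" using jk(2) by (simp add: algebra_simps)
    ultimately show "\<exists>z. to_circle z \<in> Z \<and> (\<exists>k\<in>\<int>. \<bar>z - y - k\<bar> < e)" using jk(1) by blast
  qed
  then have "interior Z \<noteq> {}" by simp
  with interior_finite_translates[OF \<open>finite F\<close>] K show ?thesis
    unfolding Z_def alpha_set_def by blast
qed

text \<open>If \<open>p i\<close> were \<open>0\<close>, then \<open>\<alpha> i\<close> would be rational. With opposite signs, \<open>\<bar>p j\<bar> * \<alpha> i + \<bar>p i\<bar> * \<alpha> j\<close> would be a rational number.\<close>

lemma nonneg_rat_independent_same_sign:
  fixes \<gamma> :: real and p q :: "nat \<Rightarrow> rat"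
  assumes ind: "nonneg_rat_independent_mod1 l \<alpha>"
    and \<alpha>: "\<And>i. i \<in> {1..l} \<Longrightarrow> \<alpha> i = of_rat (p i) * \<gamma> + of_rat (q i)"
    and ij: "i \<in> {1..l}" "j \<in> {1..l}"
  shows "p i * p j > 0"
proof -
  have nz: "p k \<noteq> 0" if "k \<in> {1..l}" for k
    using nonneg_rat_independent_irrational[OF ind that] \<alpha>[OF that] by auto
  have False if neg: "p i * p j < 0"
  proof -
    define t where "t k = (if k = i then \<bar>p j\<bar> else 0) + (if k = j then \<bar>p i\<bar> else 0)" for k
    have "(\<Sum>k=1..l. of_rat (t k) * \<alpha> k)
      = (\<Sum>k=1..l. (if k = i then of_rat \<bar>p j\<bar> * \<alpha> k else 0) + (if k = j then of_rat \<bar>p i\<bar> * \<alpha> k else 0))"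
      by (intro sum.cong) (auto simp: t_def of_rat_add algebra_simps)
    also have "\<dots> = of_rat \<bar>p j\<bar> * \<alpha> i + of_rat \<bar>p i\<bar> * \<alpha> j"
      using ij by (simp add: sum.distrib)
    also have "\<dots> = of_rat (\<bar>p j\<bar> * p i + \<bar>p i\<bar> * p j) * \<gamma> + of_rat (\<bar>p j\<bar> * q i + \<bar>p i\<bar> * q j)"
      using ij by (simp add: \<alpha> of_rat_add of_rat_mult algebra_simps)
    also have "\<bar>p j\<bar> * p i + \<bar>p i\<bar> * p j = 0"
      using neg by (auto simp: mult_less_0_iff abs_if)
    finally have "(\<Sum>k=1..l. of_rat (t k) * \<alpha> k) \<in> \<rat>" by simp
    then have "t i = 0"
      using nonneg_rat_independent_Rats[OF ind, of t i] ij by (auto simp: t_def)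
    then show False using nz[OF ij(2)] by (simp add: t_def split: if_splits)
  qed
  moreover have "p i * p j \<noteq> 0" using nz ij by simp
  ultimately show ?thesis by (metis linorder_neqE)
qed

lemma interior_if_rational_line:
  fixes \<gamma> :: real and p q :: "nat \<Rightarrow> rat"
  assumes ind: "nonneg_rat_independent_mod1 l \<alpha>" and K: "alpha_set l \<alpha> K" and \<gamma>: "\<gamma> \<notin> \<rat>"
    and \<alpha>: "\<And>i. i \<in> {1..l} \<Longrightarrow> \<alpha> i = of_rat (p i) * \<gamma> + of_rat (q i)"
  shows "interior K \<noteq> {}"
proof -
  have sign: "p i * p j > 0" if "i \<in> {1..l}" "j \<in> {1..l}" for i j
    using nonneg_rat_independent_same_sign[OF ind \<alpha> that] by simp
  show ?thesis
  proof (cases "\<forall>i\<in>{1..l}. p i > 0")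
    case True
    then show ?thesis using interior_single_direction[OF K \<gamma> \<alpha>] by blast
  next
    case False
    then obtain j where j: "j \<in> {1..l}" "p j \<le> 0" by force
    have "- p i > 0" if "i \<in> {1..l}" for i
      using sign[of i j] that j by (auto simp: zero_less_mult_iff)
    moreover have "- \<gamma> \<notin> \<rat>" using \<gamma> by simp
    moreover have "\<alpha> i = of_rat (- p i) * (- \<gamma>) + of_rat (q i)" if "i \<in> {1..l}" for i
      using \<alpha>[OF that] by (simp add: of_rat_minus)
    ultimately show ?thesis
      using interior_single_direction[OF K, of "- \<gamma>" "\<lambda>i. - p i" q] by blast
  qed
qed

text \<open>In rank one a basis \<open>{1, \<gamma>}\<close> of the rational span puts all steps on one rational line.\<close>

lemma interior_rank_one:
  assumes ind: "nonneg_rat_independent_mod1 l \<alpha>" and K: "alpha_set l \<alpha> K"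
    and r: "rat_rank l \<alpha> = 1"
  shows "interior K \<noteq> {}"
proof -
  let ?V = "insert 1 (\<alpha> ` {1..l})"
  have "rat_real.independent {1::real}" by (simp add: rat_real.independent_insert)
  then obtain B where B: "{1} \<subseteq> B" "B \<subseteq> ?V" "rat_real.independent B" "?V \<subseteq> rat_real.span B"
    using rat_real.maximal_independent_subset_extend[of "{1}" ?V] by auto
  have "rat_real.span B = rat_real.span ?V"
    using B by (metis rat_real.span_minimal rat_real.span_mono rat_real.subspace_span subset_antisym)
  then have "card B = rat_real.dim (rat_real.span ?V)"
    using B(3) by (metis rat_real.dim_span rat_real.dim_eq_card)
  then have "card B = 2" using r by (simp add: rat_rank_def)
  then obtain \<gamma> where \<gamma>: "B = {1, \<gamma>}" "\<gamma> \<noteq> 1"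
    using B(1) by (auto simp: card_2_iff doubleton_eq_iff)
  have "\<gamma> \<notin> rat_real.span {1}"
    using B(3) \<gamma> rat_real.independent_insert[of \<gamma> "{1}"] by (simp add: insert_commute)
  then have irr: "\<gamma> \<notin> \<rat>"
    by (auto simp: rat_real.span_singleton elim: Rats_cases)
  have "\<exists>p q. \<alpha> i = of_rat p * \<gamma> + of_rat q" if "i \<in> {1..l}" for i
  proof -
    have "\<alpha> i \<in> rat_real.span {1, \<gamma>}" using that B(4) \<gamma>(1) by blast
    then obtain c d where "\<alpha> i - of_rat c * \<gamma> = of_rat d"
      by (subst (asm) insert_commute) (auto simp: rat_real.span_insert rat_real.span_singleton)
    then show ?thesis by (intro exI[of _ c] exI[of _ d]) linarith
  qed
  then obtain p q where "\<And>i. i \<in> {1..l} \<Longrightarrow> \<alpha> i = of_rat (p i) * \<gamma> + of_rat (q i)"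
    by (metis (no_types))
  from interior_if_rational_line[OF ind K irr this] show ?thesis by blast
qed

section \<open>Two directions\<close>

text \<open>The slope \<open>\<theta>\<close> is the supremum of all \<open>(f n - L) / n\<close>: comparing \<open>f (m * n)\<close> with \<open>m * f n\<close> and
  with \<open>n * f m\<close> shows that each of these numbers is at most each \<open>(f m + L) / m\<close>.\<close>

lemma quasi_additive:
  fixes f :: "nat \<Rightarrow> real"
  assumes quasi: "\<And>m n. \<bar>f (m + n) - f m - f n\<bar> \<le> L"
  obtains \<theta> where "\<And>n. \<bar>f n - real n * \<theta>\<bar> \<le> L"
proof -
  have L0: "\<bar>f 0\<bar> \<le> L" using quasi[of 0 0] by simp
  have mult: "\<bar>f (k * n) - real k * f n\<bar> \<le> real k * L" if "k \<ge> 1" for k n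
    using that
  proof (induction k rule: nat_induct_at_least)
    case base
    then show ?case using L0 by simp
  next
    case (Suc k)
    have "\<bar>f (k * n + n) - f (k * n) - f n\<bar> \<le> L" by (rule quasi)
    with Suc.IH show ?case by (simp add: algebra_simps)
  qed
  have cross: "(f n - L) / real n \<le> (f m + L) / real m" if "n \<ge> 1" "m \<ge> 1" for m n
  proof -
    have "\<bar>f (m * n) - real m * f n\<bar> \<le> real m * L" "\<bar>f (m * n) - real n * f m\<bar> \<le> real n * L"
      using mult[OF that(2), of n] mult[OF that(1), of m] by (simp_all add: mult.commute)
    then have "real m * (f n - L) \<le> real n * (f m + L)" by (simp add: algebra_simps)
    then show ?thesis using that by (simp add: field_simps)
  qed
  define \<theta> where "\<theta> = (SUP n\<in>{1..}. (f n - L) / real n)"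
  have upper: "\<theta> \<le> (f m + L) / real m" if "m \<ge> 1" for m
    unfolding \<theta>_def using cross that by (intro cSUP_least) auto
  have lower: "(f n - L) / real n \<le> \<theta>" if "n \<ge> 1" for n
    unfolding \<theta>_def using cross[of _ 1] that by (intro cSUP_upper) (auto intro!: bdd_aboveI2)
  have "\<bar>f n - real n * \<theta>\<bar> \<le> L" for n
  proof (cases "n = 0")
    case False
    then show ?thesis using upper[of n] lower[of n] by (simp add: field_simps abs_le_iff)
  qed (use L0 in simp)
  with that show thesis by blast
qed

lemma int_intermediate_value:
  fixes f :: "nat \<Rightarrow> int"
  assumes step: "\<And>m. \<bar>f (Suc m) - f m\<bar> \<le> 1" and v: "f m \<le> v" "v \<le> f m'"
  obtains i where "f i = v"
proof (cases "m \<le> m'")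
  case True
  from nat_intermed_int_val[OF _ True v] step that show thesis by blast
next
  case False
  have "\<exists>i\<ge>m'. i \<le> m \<and> - f i = - v"
    using nat_intermed_int_val[of m' m "\<lambda>i. - f i" "- v"] step v False
    by (auto simp: abs_minus_commute)
  with that show thesis by auto
qed

text \<open>The strip \<open>\<bar>a - n \<theta>\<bar> \<le> 1\<close> of integer pairs \<open>(n, a)\<close> with \<open>n \<ge> 0\<close> is mapped to the circle by
  \<open>(n, a) \<mapsto> n \<beta> + a \<gamma>\<close>. A vector \<open>(n, a, k)\<close> is described by its displacement
  \<open>d = n \<beta> + a \<gamma> + k\<close> on the line and its deviation \<open>\<tau> = a - n \<theta>\<close> from the axis of the strip.
  By Dirichlet's theorem both can be made small, and the last assumption keeps \<open>d\<close> nonzero. If they can be made small with \<open>\<bar>\<tau>\<bar> \<le> C \<bar>d\<bar>\<close>, then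
  the multiples of such vectors, those moving in a suitable one of the two directions, stay in the
  strip long enough to fill an arc of length \<open>1 / C\<close>.
  Otherwise the short vectors are almost parallel to the deviation axis. Then any point of the
  dense set of all \<open>a \<gamma>\<close> can be brought back into the strip by short vectors, with a negligible
  change of its displacement.\<close>

lemma interior_strip:
  fixes \<beta> \<gamma> \<theta> \<xi> :: real
  assumes \<gamma>: "\<gamma> \<notin> \<rat>" and Z: "closed Z"
    and strip: "\<And>(n::nat) (a::int). \<bar>of_int a - real n * \<theta>\<bar> \<le> 1 \<Longrightarrow>
      to_circle (\<xi> + (real n * \<beta> + of_int a * \<gamma>)) \<in> Z"
    and \<theta>: "0 \<le> \<theta>" "\<theta> \<le> 1"
    and nz: "\<And>(n::nat) (a::int). n \<ge> 1 \<Longrightarrow> 0 \<le> a \<Longrightarrow> a \<le> int n \<Longrightarrow> real n * \<beta> + of_int a * \<gamma> \<notin> \<int>"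
  shows "interior Z \<noteq> {}"
proof -
  define d where "d n a k = real n * \<beta> + of_int a * \<gamma> + of_int k" for n :: nat and a k :: int
  define \<tau> where "\<tau> n a = of_int a - real n * \<theta>" for n :: nat and a :: int
  have small: "\<exists>n a k. n \<ge> 1 \<and> \<bar>d n a k\<bar> < e \<and> \<bar>\<tau> n a\<bar> < e \<and> d n a k \<noteq> 0" if "e > 0" for e
  proof -
    \<comment> \<open>\<open>d\<close> is the error of a simultaneous approximation plus \<open>\<tau> * \<gamma>\<close>, hence the factor\<close>
    define e' where "e' = min e 1 / (1 + \<bar>\<gamma>\<bar>)"
    have "e' > 0" using that by (auto simp: e'_def intro!: divide_pos_pos)
    then obtain N :: nat where N: "N > 0" "1 / real N < e'"
      using real_arch_inverse[of e'] by (auto simp: inverse_eq_divide)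
    define \<theta>' where "\<theta>' i = (if i = 0 then \<theta> else \<beta> + \<theta> * \<gamma>)" for i :: nat
    obtain q p where q: "0 < q" "q \<le> int (N ^ 2)"
      and p: "\<And>i. i < 2 \<Longrightarrow> \<bar>of_int q * \<theta>' i - of_int (p i)\<bar> < 1 / N"
      using Dirichlet_approx_simult[OF N(1), where n = 2 and \<theta> = \<theta>'] by metis
    define n a k where "n = nat q" and "a = p 0" and "k = - p 1"
    have n: "n \<ge> 1" "real n = of_int q" using q by (auto simp: n_def)
    have t: "\<bar>\<tau> n a\<bar> < e'"
      using p[of 0] N(2) by (simp add: \<tau>_def a_def \<theta>'_def n)
    have dd: "d n a k = (real n * (\<beta> + \<theta> * \<gamma>) - of_int (p 1)) + \<tau> n a * \<gamma>"
      by (simp add: d_def \<tau>_def k_def algebra_simps)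
    have "\<bar>real n * (\<beta> + \<theta> * \<gamma>) - of_int (p 1)\<bar> < e'"
      using p[of 1] N(2) by (simp add: \<theta>'_def n)
    moreover have "\<bar>\<tau> n a * \<gamma>\<bar> \<le> e' * \<bar>\<gamma>\<bar>"
      using t by (simp add: abs_mult mult_right_mono)
    ultimately have "\<bar>d n a k\<bar> < e' + e' * \<bar>\<gamma>\<bar>" unfolding dd by linarith
    also have e'_eq: "e' + e' * \<bar>\<gamma>\<bar> = min e 1"
      by (simp add: e'_def field_simps add_nonneg_eq_0_iff)
    finally have dsmall: "\<bar>d n a k\<bar> < e" by simp
    have "e' \<le> min e 1"
      unfolding e'_eq[symmetric] using \<open>e' > 0\<close> by simp
    with t have tsmall: "\<bar>\<tau> n a\<bar> < e" "\<bar>\<tau> n a\<bar> < 1" by auto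
    have "real n * \<theta> \<ge> 0" "real n * \<theta> \<le> real n"
      using \<theta> by (auto simp: mult_left_le)
    with tsmall(2) have "real_of_int a > -1" "real_of_int a < real n + 1"
      unfolding \<tau>_def by linarith+
    then have "0 \<le> a" "a \<le> int n" by linarith+
    then have "real n * \<beta> + of_int a * \<gamma> \<notin> \<int>" using nz n(1) by blast
    moreover have "real n * \<beta> + of_int a * \<gamma> = of_int (- k)" if "d n a k = 0"
      using that by (simp add: d_def)
    ultimately have "d n a k \<noteq> 0" by (metis Ints_of_int)
    with n(1) dsmall tsmall(1) show ?thesis by blast
  qed
  have multiple: "to_circle (\<xi> + (of_int b * \<gamma> + real j * d n a k)) \<in> Z"
    if "\<bar>of_int b + real j * \<tau> n a\<bar> \<le> 1" for j n :: nat and a b k :: int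
  proof -
    have "to_circle (\<xi> + (real (j * n) * \<beta> + of_int (b + int j * a) * \<gamma>)) \<in> Z"
      using that by (intro strip) (simp add: \<tau>_def algebra_simps)
    moreover have "\<xi> + (of_int b * \<gamma> + real j * d n a k)
        = \<xi> + (real (j * n) * \<beta> + of_int (b + int j * a) * \<gamma>) + of_int (int j * k)"
      by (simp add: d_def algebra_simps)
    ultimately show ?thesis by (simp only: to_circle_add_int[OF Ints_of_int])
  qed
  define S where "S e C \<sigma> \<longleftrightarrow> (\<exists>n a k. n \<ge> 1 \<and> \<bar>d n a k\<bar> < e \<and> \<bar>\<tau> n a\<bar> \<le> C * \<bar>d n a k\<bar> \<and> \<sigma> * d n a k > 0)"
    for e C \<sigma> :: real
  have fill: "to_circle (\<xi> + \<sigma> * y) \<in> Z"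
    if C: "C > 0" and S: "\<And>e. e > 0 \<Longrightarrow> S e C \<sigma>" and y: "0 \<le> y" "y \<le> 1 / C" and \<sigma>: "\<bar>\<sigma>\<bar> = 1" for C \<sigma> y
  proof -
    have "to_circle (\<xi> + \<sigma> * y) \<in> closure Z"
      unfolding closure_approachable
    proof (intro allI impI)
      fix e :: real assume "e > 0"
      then obtain n a k where u: "n \<ge> 1" "\<bar>d n a k\<bar> < e" "\<bar>\<tau> n a\<bar> \<le> C * \<bar>d n a k\<bar>" "\<sigma> * d n a k > 0"
        using S unfolding S_def by blast
      define D where "D = \<bar>d n a k\<bar>"
      have D: "D > 0" "d n a k = \<sigma> * D"
        using u(4) \<sigma> by (auto simp: D_def abs_if zero_less_mult_iff split: if_splits)
      define j where "j = nat \<lfloor>y / D\<rfloor>"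
      have "real j \<le> y / D" "y / D < real j + 1" using y(1) D(1) by (auto simp: j_def)
      then have j: "real j * D \<le> y" "y < real j * D + D" using D(1) by (auto simp: field_simps)
      have "\<bar>real j * \<tau> n a\<bar> \<le> real j * (C * D)"
        using u(3) by (simp add: abs_mult D_def mult_left_mono)
      also have "\<dots> \<le> C * y" using j(1) C by (simp add: mult.left_commute)
      also have "\<dots> \<le> 1" using y(2) C by (simp add: field_simps)
      finally have "to_circle (\<xi> + (of_int 0 * \<gamma> + real j * d n a k)) \<in> Z"
        by (intro multiple) simp
      moreover have "dist (to_circle (\<xi> + (of_int 0 * \<gamma> + real j * d n a k))) (to_circle (\<xi> + \<sigma> * y))
          \<le> \<bar>real j * d n a k - \<sigma> * y\<bar>"
        using dist_to_circle_le_int[of 0 "\<xi> + (of_int 0 * \<gamma> + real j * d n a k)" "\<xi> + \<sigma> * y"] by simp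
      moreover have "\<bar>real j * d n a k - \<sigma> * y\<bar> = \<bar>\<sigma>\<bar> * \<bar>real j * D - y\<bar>"
        unfolding D(2) by (simp flip: abs_mult add: algebra_simps)
      moreover have "\<bar>real j * D - y\<bar> < e" using j u(2) by (simp add: D_def)
      ultimately show "\<exists>q\<in>Z. dist q (to_circle (\<xi> + \<sigma> * y)) < e" using \<sigma> by force
    qed
    with Z show ?thesis by simp
  qed
  show ?thesis
  proof (cases "\<exists>C>0. \<forall>e>0. S e C 1 \<or> S e C (- 1)")
    case True
    then obtain C where C: "C > 0" "\<And>e. e > 0 \<Longrightarrow> S e C 1 \<or> S e C (- 1)" by blast
    have mono: "S e C \<sigma> \<Longrightarrow> e \<le> e' \<Longrightarrow> S e' C \<sigma>" for e e' \<sigma>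
      unfolding S_def by (meson order_less_le_trans)
    show ?thesis
    proof (cases "\<forall>e>0. S e C 1")
      case True
      then have pos: "S e C 1" if "e > 0" for e using that by blast
      show ?thesis
      proof (rule interior_circle_arc[of \<xi> "\<xi> + 1 / C"])
        fix y assume "\<xi> < y" "y < \<xi> + 1 / C"
        then show "to_circle y \<in> Z"
          using fill[OF C(1) pos, of "y - \<xi>"] by simp
      qed (use C(1) in simp)
    next
      case False
      then obtain e0 where "e0 > 0" "\<not> S e0 C 1" by blast
      then have neg: "S e C (- 1)" if "e > 0" for e
        using C(2)[of "min e e0"] mono[of "min e e0" 1 e0] mono[of "min e e0" "-1" e] that by auto
      show ?thesis
      proof (rule interior_circle_arc[of "\<xi> - 1 / C" \<xi>])
        fix y assume "\<xi> - 1 / C < y" "y < \<xi>"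
        then show "to_circle y \<in> Z"
          using fill[OF C(1) neg, of "\<xi> - y"] by simp
      qed (use C(1) in simp)
    qed
  next
    case False
    have steep: "\<exists>e0>0. \<forall>n a k. n \<ge> 1 \<longrightarrow> \<bar>d n a k\<bar> < e0 \<longrightarrow> d n a k \<noteq> 0 \<longrightarrow> \<bar>\<tau> n a\<bar> > C * \<bar>d n a k\<bar>"
      if C: "C > 0" for C
    proof -
      obtain e0 where e0: "e0 > 0" "\<not> S e0 C 1" "\<not> S e0 C (- 1)" using False C by blast
      have "\<bar>\<tau> n a\<bar> > C * \<bar>d n a k\<bar>" if "n \<ge> 1" "\<bar>d n a k\<bar> < e0" "d n a k \<noteq> 0" for n a k
      proof (rule ccontr)
        assume "\<not> \<bar>\<tau> n a\<bar> > C * \<bar>d n a k\<bar>"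
        then have "d n a k > 0 \<Longrightarrow> S e0 C 1" "d n a k < 0 \<Longrightarrow> S e0 C (- 1)"
          unfolding S_def using that by force+
        with e0 that(3) show False by linarith
      qed
      with e0(1) show ?thesis by blast
    qed
    have "Z = UNIV"
    proof (rule closed_circle_eq_UNIV[OF Z])
      fix y e :: real assume "e > 0"
      have "\<exists>j::nat. \<exists>k\<in>\<int>. \<bar>real j * \<gamma>' - (y - \<xi>) - k\<bar> < e / 2" if "\<gamma>' \<notin> \<rat>" for \<gamma>'
        using irrational_multiples_uniformly_dense[OF that, of "e / 2"] \<open>e > 0\<close> by (metis half_gt_zero)
      from this[OF \<gamma>] this[of "- \<gamma>"] \<gamma> obtain j1 j2 :: nat and k1 k2 where
        j: "k1 \<in> \<int>" "\<bar>real j1 * \<gamma> - (y - \<xi>) - k1\<bar> < e / 2"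
           "k2 \<in> \<int>" "\<bar>real j2 * - \<gamma> - (y - \<xi>) - k2\<bar> < e / 2" by auto
      \<comment> \<open>so steep that cancelling the deviation of \<open>j1\<close> or \<open>- j2\<close> moves the point by at most \<open>e / 2\<close>\<close>
      define C where "C = 2 * (real j1 + real j2 + 1) / e"
      have "C > 0" using \<open>e > 0\<close> by (simp add: C_def add_nonneg_pos)
      then obtain e0 where e0: "e0 > 0" "\<And>n a k. n \<ge> 1 \<Longrightarrow> \<bar>d n a k\<bar> < e0 \<Longrightarrow> d n a k \<noteq> 0 \<Longrightarrow> \<bar>\<tau> n a\<bar> > C * \<bar>d n a k\<bar>"
        using steep by blast
      obtain n a k where u: "n \<ge> 1" "\<bar>d n a k\<bar> < min e0 1" "\<bar>\<tau> n a\<bar> < min e0 1" "d n a k \<noteq> 0"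
        using small[of "min e0 1"] e0(1) by auto
      define T where "T = \<bar>\<tau> n a\<bar>"
      have T: "T > C * \<bar>d n a k\<bar>" "T \<le> 1" using e0(2)[OF u(1) _ u(4)] u by (auto simp: T_def)
      have "T > 0" using T(1) u(4) \<open>C > 0\<close> by (meson less_trans mult_pos_pos zero_less_abs_iff)
      \<comment> \<open>the deviation of the starting point and that of the short vector must have opposite signs\<close>
      define b where "b = (if \<tau> n a > 0 then - int j2 else int j1)"
      obtain k' where k': "k' \<in> \<int>" "\<bar>of_int b * \<gamma> - (y - \<xi>) - k'\<bar> < e / 2"
        using j by (cases "\<tau> n a > 0") (auto simp: b_def)
      define B where "B = \<bar>real_of_int b\<bar>"
      have B: "B \<le> real j1 + real j2" by (simp add: B_def b_def)
      define i where "i = nat \<lfloor>B / T\<rfloor>"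
      have "real i \<le> B / T" "B / T < real i + 1" using \<open>T > 0\<close> by (auto simp: i_def B_def)
      then have i: "real i * T \<le> B" "B < real i * T + T" using \<open>T > 0\<close> by (auto simp: field_simps)
      have "\<bar>of_int b + real i * \<tau> n a\<bar> = \<bar>B - real i * T\<bar>"
        by (simp add: B_def b_def T_def abs_if)
      also have "\<dots> \<le> 1" using i T(2) by linarith
      finally have mem: "to_circle (\<xi> + (of_int b * \<gamma> + real i * d n a k)) \<in> Z" by (rule multiple)
      have "C * \<bar>real i * d n a k\<bar> = real i * (C * \<bar>d n a k\<bar>)" by (simp add: abs_mult)
      also have "\<dots> \<le> real i * T" using T(1) by (intro mult_left_mono) auto
      also have "\<dots> \<le> B" by (rule i)
      also have "\<dots> \<le> C * (e / 2)" using B \<open>e > 0\<close> by (simp add: C_def)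
      finally have "\<bar>real i * d n a k\<bar> \<le> e / 2" using \<open>C > 0\<close> by simp
      with k'(2) have "\<bar>\<xi> + (of_int b * \<gamma> + real i * d n a k) - y - k'\<bar> < e" by linarith
      with mem k'(1) show "\<exists>z. to_circle z \<in> Z \<and> (\<exists>k\<in>\<int>. \<bar>z - y - k\<bar> < e)" by blast
    qed
    then show ?thesis by simp
  qed
qed

text \<open>Let \<open>a n\<close> count the steps \<open>\<alpha> 1\<close> among the first \<open>n\<close> steps of an orbit, so that the orbit is at
  \<open>\<xi> + n \<beta> + a n * \<gamma>\<close> with \<open>\<beta> = \<alpha> 2\<close> and \<open>\<gamma> = \<alpha> 1 - \<alpha> 2\<close>. For a fixed time lag \<open>k\<close> the increment
  \<open>a (m + k) - a m\<close> changes by at most \<open>1\<close> with \<open>m\<close> and hence takes all intermediate values. If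
  its range has unbounded length as \<open>k\<close> varies, the differences of the orbit contain arbitrarily long
  progressions of step \<open>\<gamma>\<close>, which become dense. If not, \<open>a n\<close> is linear up to a bounded error and
  finitely many translates of \<open>K\<close> contain the image of a strip.\<close>

lemma difference_set_or_interior_two:
  assumes ind: "nonneg_rat_independent_mod1 2 \<alpha>" and K: "alpha_set 2 \<alpha> K"
  shows "difference_set K = UNIV \<or> interior K \<noteq> {}"
proof (cases "\<alpha> 1 - \<alpha> 2 \<in> \<rat>")
  case True
  then obtain q where q: "\<alpha> 1 - \<alpha> 2 = of_rat q" by (auto elim: Rats_cases)
  have "interior K \<noteq> {}"
  proof (rule interior_if_rational_line[OF ind K])
    show "\<alpha> 2 \<notin> \<rat>" by (rule nonneg_rat_independent_irrational[OF ind]) simp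
    fix i :: nat assume "i \<in> {1..2}"
    then have "i = 1 \<or> i = 2" by auto
    then show "\<alpha> i = of_rat 1 * \<alpha> 2 + of_rat (if i = 1 then q else 0)"
      using q by auto
  qed
  then show ?thesis ..
next
  case False
  define \<beta> \<gamma> where "\<beta> = \<alpha> 2" and "\<gamma> = \<alpha> 1 - \<alpha> 2"
  have \<gamma>: "\<gamma> \<notin> \<rat>" using False by (simp add: \<gamma>_def)
  obtain i :: "nat \<Rightarrow> nat" and \<xi> where
    orbit: "\<And>n. i n \<in> {1..2}" "\<And>n. to_circle (\<xi> + (\<Sum>m<n. \<alpha> (i m))) \<in> K"
    using alpha_set_orbit[OF K] by blast
  define a where "a n = (\<Sum>m<n. if i m = 1 then 1 else 0 :: int)" for n
  have sum_eq: "(\<Sum>m<n. \<alpha> (i m)) = real n * \<beta> + of_int (a n) * \<gamma>" for n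
  proof -
    have "\<alpha> (i m) = \<beta> + of_int (if i m = 1 then 1 else 0) * \<gamma>" for m
    proof -
      have "i m = 1 \<or> i m = 2" using orbit(1)[of m] by auto
      then show ?thesis by (auto simp: \<beta>_def \<gamma>_def)
    qed
    then show ?thesis
      by (simp only: a_def sum.distrib of_int_sum sum_distrib_right) simp
  qed
  have a_step: "a (Suc n) = a n \<or> a (Suc n) = a n + 1" for n by (simp add: a_def)
  have a_bounds: "0 \<le> a n" "a n \<le> int n" for n
  proof -
    show "0 \<le> a n" by (simp add: a_def sum_nonneg)
    show "a n \<le> int n"
    proof (induction n)
      case (Suc n)
      then show ?case using a_step[of n] by auto
    qed (simp add: a_def)
  qed
  have a0: "a 0 = 0" by (simp add: a_def)
  define g where "g k m = a (m + k) - a m" for k m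
  show ?thesis
  proof (cases "\<forall>L::nat. \<exists>k m m'. g k m' - g k m \<ge> int L")
    \<comment> \<open>unbounded discrepancy: at a suitable time lag the differences form a long progression\<close>
    case True
    have "difference_set K = UNIV"
    proof (rule closed_circle_eq_UNIV)
      show "closed (difference_set K)"
        using K by (intro closed_difference_set) (simp add: alpha_set_def)
      fix y e :: real assume "e > 0"
      obtain J where J: "\<And>y. \<exists>j\<le>J. \<exists>k\<in>\<int>. \<bar>real j * \<gamma> - y - k\<bar> < e"
        using irrational_multiples_uniformly_dense[OF \<gamma> \<open>e > 0\<close>] by blast
      obtain k m m' where km: "g k m' - g k m \<ge> int J" using True by blast
      obtain j h where j: "j \<le> J" "h \<in> \<int>"
        "\<bar>real j * \<gamma> - (y - (real k * \<beta> + of_int (g k m) * \<gamma>)) - h\<bar> < e"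
        using J by blast
      have "\<bar>g k (Suc m) - g k m\<bar> \<le> 1" for m
        using a_step[of m] a_step[of "m + k"] by (auto simp: g_def)
      then obtain m'' where m'': "g k m'' = g k m + int j"
        using int_intermediate_value[of "g k" m "g k m + int j" m'] km j(1) by force
      define z where "z = (\<Sum>n<m'' + k. \<alpha> (i n)) - (\<Sum>n<m''. \<alpha> (i n))"
      have "z = real k * \<beta> + of_int (g k m'') * \<gamma>"
        by (simp add: z_def sum_eq g_def algebra_simps)
      then have "\<bar>z - y - h\<bar> < e" using j(3) by (simp add: m'' algebra_simps)
      moreover have "to_circle z = to_circle (\<xi> + (\<Sum>n<m'' + k. \<alpha> (i n))) - to_circle (\<xi> + (\<Sum>n<m''. \<alpha> (i n)))"
        by (simp add: z_def flip: to_circle_diff)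
      then have "to_circle z \<in> difference_set K"
        unfolding difference_set_def using orbit(2) by blast
      ultimately show "\<exists>z. to_circle z \<in> difference_set K \<and> (\<exists>k\<in>\<int>. \<bar>z - y - k\<bar> < e)"
        using j(2) by blast
    qed
    then show ?thesis ..
  next
    \<comment> \<open>bounded discrepancy: up to finitely many translates the orbit is a full strip\<close>
    case False
    then obtain L :: nat where L: "\<And>k m m'. g k m' - g k m < int L" by (metis not_le)
    have "\<bar>real_of_int (a (m + n)) - of_int (a m) - of_int (a n)\<bar> \<le> real L" for m n
    proof -
      have "a (m + n) - a m = g n m" "a n = g n 0" by (simp_all add: g_def a0)
      then have "\<bar>a (m + n) - a m - a n\<bar> \<le> int L" using L[of n m 0] L[of n 0 m] by linarith
      then show ?thesis by linarith
    qed
    then obtain \<theta> where \<theta>: "\<And>n. \<bar>of_int (a n) - real n * \<theta>\<bar> \<le> real L"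
      using quasi_additive[of "\<lambda>n. of_int (a n)" "real L"] by blast
    have "\<theta> \<ge> 0"
    proof (rule ccontr)
      assume "\<not> \<theta> \<ge> 0"
      then obtain n where "real L < real n * (- \<theta>)" using reals_Archimedean3[of "- \<theta>"] by auto
      moreover have "real_of_int (a n) \<ge> 0" using a_bounds(1) by simp
      ultimately show False using \<theta>[of n] by linarith
    qed
    have "\<theta> \<le> 1"
    proof (rule ccontr)
      assume "\<not> \<theta> \<le> 1"
      then obtain n where "real L < real n * (\<theta> - 1)" using reals_Archimedean3[of "\<theta> - 1"] by auto
      moreover have "real_of_int (a n) \<le> real n" using a_bounds(2)[of n] by linarith
      ultimately show False using \<theta>[of n] by (simp add: algebra_simps)
    qed
    define F where "F = (\<lambda>f::int. to_circle (of_int f * \<gamma>)) ` {- int L - 1..int L + 1}"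
    define Z where "Z = (\<Union>c\<in>F. (\<lambda>p. p + c) ` K)"
    have "finite F" by (simp add: F_def)
    have "interior Z \<noteq> {}"
    proof (rule interior_strip[OF \<gamma>])
      show "closed Z"
        unfolding Z_def using \<open>finite F\<close> K closed_circle_translate by (auto simp: alpha_set_def)
    next
      fix n :: nat and b :: int
      assume b: "\<bar>of_int b - real n * \<theta>\<bar> \<le> 1"
      define f where "f = b - a n"
      have "\<bar>real_of_int f\<bar> \<le> real L + 1" using b \<theta>[of n] by (simp add: f_def)
      then have "f \<in> {- int L - 1..int L + 1}" by auto
      then have "to_circle (of_int f * \<gamma>) \<in> F" by (simp add: F_def)
      moreover have "to_circle (\<xi> + (real n * \<beta> + of_int b * \<gamma>))
          = to_circle (\<xi> + (\<Sum>m<n. \<alpha> (i m))) + to_circle (of_int f * \<gamma>)"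
        by (simp add: sum_eq f_def algebra_simps flip: to_circle_add)
      ultimately show "to_circle (\<xi> + (real n * \<beta> + of_int b * \<gamma>)) \<in> Z"
        unfolding Z_def using orbit(2)[of n] by auto
    next
      fix n :: nat and b :: int
      assume n: "n \<ge> 1" "0 \<le> b" "b \<le> int n"
      define t where "t j = (if j = 1 then of_int b else of_int (int n - b) :: rat)" for j :: nat
      have "(\<Sum>j=1..2. of_rat (t j) * \<alpha> j) = real n * \<beta> + of_int b * \<gamma>"
        by (simp add: t_def numeral_2_eq_2 of_rat_diff \<beta>_def \<gamma>_def algebra_simps)
      moreover have "\<forall>j\<in>{1..2}. t j \<ge> 0" using n by (simp add: t_def)
      moreover have "\<not> (\<forall>j\<in>{1..2}. t j = 0)"
      proof (cases "b = 0")
        case True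
        then have "t 2 \<noteq> 0" using n by (simp add: t_def)
        then show ?thesis by auto
      next
        case False
        then have "t 1 \<noteq> 0" by (simp add: t_def)
        then show ?thesis by auto
      qed
      ultimately show "real n * \<beta> + of_int b * \<gamma> \<notin> \<int>"
        using spec[OF ind[unfolded nonneg_rat_independent_mod1_def], of t] by metis
    qed (use \<open>\<theta> \<ge> 0\<close> \<open>\<theta> \<le> 1\<close> in auto)
    then have "interior K \<noteq> {}"
      using interior_finite_translates[OF \<open>finite F\<close>, of K] K unfolding Z_def alpha_set_def by simp
    then show ?thesis ..
  qed
qed

section \<open>Small integer relations\<close>

text \<open>Siegel's lemma for one equation less than unknowns. With \<open>H = (2 s X) ^ (s - 1)\<close> there are
  \<open>(H + 1) ^ s\<close> vectors with entries in \<open>{0..H}\<close> but only \<open>(2 s X H + 1) ^ (s - 1)\<close> possible values of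
  the linear forms, which is less. Two vectors with the same values differ by a solution.\<close>

lemma siegel:
  fixes f :: "'b \<Rightarrow> 'w \<Rightarrow> int" and X :: nat
  assumes W: "finite W" "card W = s" and B: "finite B" "card B + 1 = s"
    and f: "\<And>b w. b \<in> B \<Longrightarrow> w \<in> W \<Longrightarrow> \<bar>f b w\<bar> \<le> int X" and X: "X \<ge> 1"
  shows "\<exists>c :: 'w \<Rightarrow> int. (\<exists>w\<in>W. c w \<noteq> 0) \<and>
    (\<forall>w\<in>W. \<bar>c w\<bar> \<le> (2 * int s * int X) ^ (s - 1)) \<and>
    (\<forall>b\<in>B. (\<Sum>w\<in>W. c w * f b w) = 0)"
proof -
  have s: "s \<ge> 1" "card B = s - 1" using B(2) by auto
  define H where "H = (2 * s * X) ^ (s - 1)"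
  define R where "R = s * X * H"
  define P where "P = (\<Pi>\<^sub>E w\<in>W. {0..int H})"
  define Q where "Q = (\<Pi>\<^sub>E b\<in>B. {- int R..int R})"
  define G where "G c = (\<lambda>b\<in>B. \<Sum>w\<in>W. c w * f b w)" for c
  have GP: "G c \<in> Q" if c: "c \<in> P" for c
    unfolding Q_def G_def
  proof (intro restrict_PiE_iff[THEN iffD2] ballI)
    fix b assume b: "b \<in> B"
    have "\<bar>\<Sum>w\<in>W. c w * f b w\<bar> \<le> (\<Sum>w\<in>W. \<bar>c w * f b w\<bar>)" by (rule sum_abs)
    also have "\<dots> \<le> (\<Sum>w\<in>W. int H * int X)"
    proof (rule sum_mono)
      fix w assume w: "w \<in> W"
      then have "c w \<in> {0..int H}" using c by (auto simp: P_def)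
      then show "\<bar>c w * f b w\<bar> \<le> int H * int X"
        using f[OF b w] by (auto simp: abs_mult intro!: mult_mono)
    qed
    also have "\<dots> = int R" by (simp add: R_def W(2))
    finally show "(\<Sum>w\<in>W. c w * f b w) \<in> {- int R..int R}" by auto
  qed
  have cardP: "card P = (H + 1) ^ s" using W by (simp add: P_def card_PiE nat_add_distrib)
  have cardQ: "card Q = (2 * R + 1) ^ (s - 1)" using B s by (simp add: Q_def card_PiE nat_add_distrib nat_mult_distrib)
  have "2 * R + 1 \<le> (2 * s * X) * (H + 1)"
    using s(1) X by (simp add: R_def algebra_simps)
  then have "card Q \<le> ((2 * s * X) * (H + 1)) ^ (s - 1)"
    unfolding cardQ by (rule power_mono) simp
  also have "\<dots> = H * (H + 1) ^ (s - 1)" by (simp only: power_mult_distrib[of _ "H + 1"] H_def[symmetric])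
  also have "\<dots> < (H + 1) * (H + 1) ^ (s - 1)" by simp
  also have "\<dots> = card P" using s(1) by (simp add: cardP power_eq_if)
  finally have "card Q < card P" .
  moreover have "finite Q" using B(1) by (auto simp: Q_def intro!: finite_PiE)
  ultimately have "\<not> inj_on G P"
    using GP card_inj_on_le[of G P Q] by (metis image_subsetI not_le)
  then obtain c c' where cc: "c \<in> P" "c' \<in> P" "c \<noteq> c'" "G c = G c'" by (auto simp: inj_on_def)
  show ?thesis
  proof (intro exI[of _ "\<lambda>w. c w - c' w"] conjI ballI)
    show "\<exists>w\<in>W. c w - c' w \<noteq> 0"
      using cc(1-3) unfolding P_def by (metis PiE_ext right_minus_eq)
    fix w assume "w \<in> W"
    then have "c w \<in> {0..int H}" "c' w \<in> {0..int H}" using cc by (auto simp: P_def)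
    then have "\<bar>c w - c' w\<bar> \<le> int H" by auto
    then show "\<bar>c w - c' w\<bar> \<le> (2 * int s * int X) ^ (s - 1)" by (simp add: H_def)
  next
    fix b assume "b \<in> B"
    then show "(\<Sum>w\<in>W. (c w - c' w) * f b w) = 0"
      using fun_cong[OF cc(4), of b] by (simp add: G_def left_diff_distrib sum_subtractf)
  qed
qed

text \<open>Independent sums of boundedly many letters from a fixed finite alphabet \<open>A\<close> cannot all be too
  small. In a basis \<open>B\<close> of the space in which they lie, they have coordinates with a fixed common
  denominator \<open>M\<close>. By Siegel's lemma a combination with small integer coefficients has only its
  coordinate at one chosen element \<open>b0\<close> left; that one is nonzero, so it is at least \<open>1 / M\<close> in absolute
  value.\<close>

lemma independent_sums_bound:
  fixes A B :: "real set"
  assumes A: "finite A" and B: "finite B" "B \<noteq> {}" "rat_real.independent B" "B \<subseteq> rat_real.span A"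
  obtains C :: real where "C > 0"
    "\<And>W X \<eta>. finite W \<Longrightarrow> card W = card B \<Longrightarrow> rat_real.independent W \<Longrightarrow> W \<subseteq> rat_real.span B \<Longrightarrow> X \<ge> 1 \<Longrightarrow>
      (\<And>w. w \<in> W \<Longrightarrow> \<bar>w\<bar> \<le> \<eta> \<and> (\<exists>as. set as \<subseteq> A \<and> length as \<le> X \<and> w = sum_list as)) \<Longrightarrow>
      C \<le> real X ^ (card B - 1) * \<eta>"
proof -
  define s where "s = card B"
  have s: "s \<ge> 1" using B(1,2) by (simp add: s_def Suc_leI card_gt_0_iff)
  obtain b0 where b0: "b0 \<in> B" using B(2) by blast
  have "b0 \<noteq> 0" using B(3) b0 rat_real.dependent_zero by blast
  \<comment> \<open>the letters need not lie in the span of \<open>B\<close>, so their coordinates refer to a larger basis\<close>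
  obtain B' where B': "B \<subseteq> B'" "B' \<subseteq> rat_real.span A" "rat_real.independent B'" "rat_real.span A \<subseteq> rat_real.span B'"
    using rat_real.maximal_independent_subset_extend[OF B(4,3)] by blast
  have AB': "a \<in> rat_real.span B'" if "a \<in> A" for a
    using that B'(4) rat_real.span_base by blast
  let ?rep = "rat_real.representation B'"
  have fin: "finite ((\<lambda>(a, b). ?rep a b) ` (A \<times> B))" using A B(1) by simp
  obtain M :: nat where M0: "M > 0" "\<And>x. x \<in> (\<lambda>(a, b). ?rep a b) ` (A \<times> B) \<Longrightarrow> of_nat M * x \<in> \<int>"
    using common_denominator[OF fin] by blast
  have M: "of_nat M * ?rep a b \<in> \<int>" if "a \<in> A" "b \<in> B" for a b
    by (rule M0(2)) (use that in force)
  define R where "R = (\<Sum>a\<in>A. \<Sum>b\<in>B. nat \<lceil>\<bar>of_nat M * ?rep a b\<bar>\<rceil>) + 1"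
  have R: "\<bar>of_nat M * ?rep a b\<bar> \<le> of_nat R" if "a \<in> A" "b \<in> B" for a b
  proof -
    have "nat \<lceil>\<bar>of_nat M * ?rep a b\<bar>\<rceil> \<le> (\<Sum>b\<in>B. nat \<lceil>\<bar>of_nat M * ?rep a b\<bar>\<rceil>)"
      using B(1) that(2) by (intro member_le_sum) auto
    also have "\<dots> \<le> (\<Sum>a\<in>A. \<Sum>b\<in>B. nat \<lceil>\<bar>of_nat M * ?rep a b\<bar>\<rceil>)"
      using A that(1) by (intro member_le_sum) auto
    finally have "nat \<lceil>\<bar>of_nat M * ?rep a b\<bar>\<rceil> \<le> R" by (simp add: R_def)
    then show ?thesis by (metis le_of_int_ceiling nat_le_iff of_int_le_iff of_int_of_nat_eq order_trans)
  qed
  have coord: "sum_list as \<in> rat_real.span B' \<and> of_nat M * ?rep (sum_list as) b \<in> \<int> \<and>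
      \<bar>of_nat M * ?rep (sum_list as) b\<bar> \<le> of_nat (R * length as)"
    if "set as \<subseteq> A" "b \<in> B" for as b
    using that(1)
  proof (induction as)
    case Nil
    then show ?case by (simp add: rat_real.representation_zero rat_real.span_zero)
  next
    case (Cons a as)
    then have IH: "sum_list as \<in> rat_real.span B'" "of_nat M * ?rep (sum_list as) b \<in> \<int>"
      "\<bar>of_nat M * ?rep (sum_list as) b\<bar> \<le> of_nat (R * length as)" and a: "a \<in> A" by auto
    have eq: "of_nat M * ?rep (sum_list (a # as)) b = of_nat M * ?rep a b + of_nat M * ?rep (sum_list as) b"
      by (simp add: rat_real.representation_add[OF B'(3)] AB'[OF a] IH(1) distrib_left)
    show ?case
      unfolding eq
    proof (intro conjI)
      show "sum_list (a # as) \<in> rat_real.span B'" using IH(1) AB'[OF a] by (simp add: rat_real.span_add)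
      show "of_nat M * ?rep a b + of_nat M * ?rep (sum_list as) b \<in> \<int>"
        using IH(2) M[OF a that(2)] by (rule Ints_add[rotated])
      have "(of_nat (R * length (a # as)) :: rat) = of_nat R + of_nat (R * length as)" by (simp add: distrib_left)
      then show "\<bar>of_nat M * ?rep a b + of_nat M * ?rep (sum_list as) b\<bar> \<le> of_nat (R * length (a # as))"
        using IH(3) R[OF a that(2)] by linarith
    qed
  qed
  define C where "C = \<bar>b0\<bar> / (real M * real s * (2 * real s * real R) ^ (s - 1))"
  have "R \<ge> 1" by (simp add: R_def)
  then have denom: "real M * real s * (2 * real s * real R) ^ (s - 1) > 0" using M0(1) s by simp
  have "C > 0" unfolding C_def using denom \<open>b0 \<noteq> 0\<close> by simp
  moreover have "C \<le> real X ^ (card B - 1) * \<eta>"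
    if W: "finite W" "card W = card B" "rat_real.independent W" "W \<subseteq> rat_real.span B" and X: "X \<ge> 1"
      and w: "\<And>w. w \<in> W \<Longrightarrow> \<bar>w\<bar> \<le> \<eta> \<and> (\<exists>as. set as \<subseteq> A \<and> length as \<le> X \<and> w = sum_list as)" for W X \<eta>
  proof -
    let ?r = "rat_real.representation B"
    have rep: "?rep w = ?r w" if "w \<in> rat_real.span B" for w
      using rat_real.representation_extend[OF B'(3) that B'(1)] .
    define f where "f b w = \<lfloor>of_nat M * ?r w b\<rfloor>" for b w
    have f: "of_nat M * ?r w b = of_int (f b w)" "\<bar>f b w\<bar> \<le> int (R * X)" if "w \<in> W" "b \<in> B" for w b
    proof -
      obtain as where as: "set as \<subseteq> A" "length as \<le> X" "w = sum_list as" using w \<open>w \<in> W\<close> by blast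
      have "w \<in> rat_real.span B" using W(4) \<open>w \<in> W\<close> by blast
      then have *: "of_nat M * ?r w b \<in> \<int>" "\<bar>of_nat M * ?r w b\<bar> \<le> of_nat (R * length as)"
        using coord[OF as(1) \<open>b \<in> B\<close>] rep as(3) by auto
      then show eq: "of_nat M * ?r w b = of_int (f b w)"
        unfolding f_def by (auto elim!: Ints_cases)
      have "R * length as \<le> R * X" using as(2) by simp
      then have "(of_nat (R * length as) :: rat) \<le> of_nat (R * X)" by (rule of_nat_mono)
      with *(2) have "\<bar>of_int (f b w) :: rat\<bar> \<le> of_int (int (R * X))" unfolding eq by simp
      then show "\<bar>f b w\<bar> \<le> int (R * X)" by (metis of_int_abs of_int_le_iff)
    qed
    have "card (B - {b0}) + 1 = s" using B(1) b0 s by (simp add: s_def)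
    moreover have "\<bar>f b w\<bar> \<le> int (R * X)" if "b \<in> B - {b0}" "w \<in> W" for b w
      using f(2) that by blast
    moreover have "R * X \<ge> 1" using \<open>R \<ge> 1\<close> X by simp
    ultimately obtain c where c: "\<exists>w\<in>W. c w \<noteq> 0"
      "\<forall>w\<in>W. \<bar>c w\<bar> \<le> (2 * int s * int (R * X)) ^ (s - 1)"
      "\<forall>b\<in>B - {b0}. (\<Sum>w\<in>W. c w * f b w) = 0"
      using siegel[OF W(1) W(2)[folded s_def] finite_Diff[OF B(1)], of "{b0}" f "R * X"] by blast
    define v where "v = (\<Sum>w\<in>W. of_int (c w) * w)"
    have v': "v = (\<Sum>w\<in>W. of_rat (of_int (c w)) * w)" by (simp add: v_def)
    have "v \<noteq> 0"
    proof
      assume "v = 0"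
      then have "rat_real.dependent W"
        unfolding rat_real.dependent_finite[OF W(1)] v' using c(1)
        by (intro exI[of _ "\<lambda>w. of_int (c w)"]) auto
      with W(3) show False by simp
    qed
    have vspan: "v \<in> rat_real.span B"
      unfolding v' using W(4) by (intro rat_real.span_sum rat_real.span_scale) auto
    have rv: "of_nat M * ?r v b = of_int (\<Sum>w\<in>W. c w * f b w)" if "b \<in> B" for b
    proof -
      have "w \<in> rat_real.span B" if "w \<in> W" for w using W(4) that by blast
      then have "?r v b = (\<Sum>w\<in>W. ?r (of_rat (of_int (c w)) * w) b)"
        unfolding v' by (subst rat_real.representation_sum[OF B(3)]) (auto intro: rat_real.span_scale simp del: of_rat_of_int_eq)
      also have "\<dots> = (\<Sum>w\<in>W. of_int (c w) * ?r w b)"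
        using W(4) by (intro sum.cong refl fun_cong[OF rat_real.representation_scale[OF B(3)]]) blast
      finally have "?r v b = (\<Sum>w\<in>W. of_int (c w) * ?r w b)" .
      then have "of_nat M * ?r v b = (\<Sum>w\<in>W. of_int (c w) * (of_nat M * ?r w b))"
        by (simp add: sum_distrib_left algebra_simps)
      also have "\<dots> = of_int (\<Sum>w\<in>W. c w * f b w)" using that by (simp add: f(1))
      finally show ?thesis .
    qed
    have zero: "?r v b = 0" if "b \<in> B - {b0}" for b
      using rv[of b] bspec[OF c(3) that] that M0(1) by simp
    have "v = (\<Sum>b\<in>B. of_rat (?r v b) * b)"
      using rat_real.sum_representation_eq[OF B(3) vspan B(1)] by simp
    also have "\<dots> = of_rat (?r v b0) * b0"
      using B(1) b0 zero by (subst sum.remove[OF B(1) b0]) simp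
    finally have v0: "v = of_rat (?r v b0) * b0" .
    define z where "z = (\<Sum>w\<in>W. c w * f b0 w)"
    have "?r v b0 = of_int z / of_nat M" using rv[OF b0] M0(1) by (simp add: z_def field_simps)
    then have vz: "real M * v = of_int z * b0"
      using v0 M0(1) by (simp add: of_rat_divide)
    then have "z \<noteq> 0" using \<open>v \<noteq> 0\<close> M0(1) by auto
    then have "\<bar>real_of_int z\<bar> \<ge> 1" by linarith
    then have "\<bar>b0\<bar> \<le> \<bar>of_int z\<bar> * \<bar>b0\<bar>" by (simp add: mult_le_cancel_right1)
    also have "\<dots> = real M * \<bar>v\<bar>" using arg_cong[OF vz, of abs] by (simp add: abs_mult)
    finally have "\<bar>b0\<bar> \<le> real M * \<bar>v\<bar>" .
    also have "\<bar>v\<bar> \<le> (\<Sum>w\<in>W. (2 * real s * real (R * X)) ^ (s - 1) * \<eta>)"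
      unfolding v_def
    proof (rule order_trans[OF sum_abs sum_mono])
      fix w' assume w': "w' \<in> W"
      have "real_of_int \<bar>c w'\<bar> \<le> real_of_int ((2 * int s * int (R * X)) ^ (s - 1))"
        using bspec[OF c(2) w'] by (simp only: of_int_le_iff)
      then have "\<bar>real_of_int (c w')\<bar> \<le> (2 * real s * real (R * X)) ^ (s - 1)" by simp
      then show "\<bar>of_int (c w') * w'\<bar> \<le> (2 * real s * real (R * X)) ^ (s - 1) * \<eta>"
        using w[OF w'] unfolding abs_mult by (intro mult_mono) auto
    qed
    also have "\<dots> = real s * (2 * real s * real R) ^ (s - 1) * (real X ^ (s - 1) * \<eta>)"
      by (simp add: W(2) flip: s_def) (simp add: power_mult_distrib)
    finally have "\<bar>b0\<bar> \<le> (real M * real s * (2 * real s * real R) ^ (s - 1)) * (real X ^ (s - 1) * \<eta>)"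
      using M0(1) by (simp add: mult.assoc mult_left_mono)
    then show ?thesis
      unfolding C_def s_def[symmetric] using denom by (simp add: divide_le_eq mult.commute)
  qed
  ultimately show thesis using that by blast
qed

section \<open>Closed chains of steps\<close>

text \<open>Here \<open>c\<close> sends a point to its cell. Consecutive pairs need only agree in the cell, not in the
  point: these jumps inside a cell are what allows cutting a chain at a repeated cell.\<close>

fun chain :: "('a \<Rightarrow> 'c) \<Rightarrow> ('a \<times> 'a) set \<Rightarrow> 'c \<Rightarrow> ('a \<times> 'a) list \<Rightarrow> 'c \<Rightarrow> bool" where
  "chain c E u [] v \<longleftrightarrow> u = v"
| "chain c E u (e # es) v \<longleftrightarrow> c (fst e) = u \<and> e \<in> E \<and> chain c E (c (snd e)) es v"

definition closed_chain :: "('a \<Rightarrow> 'c) \<Rightarrow> ('a \<times> 'a) set \<Rightarrow> ('a \<times> 'a) list \<Rightarrow> bool" where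
  "closed_chain c E es \<longleftrightarrow> es \<noteq> [] \<and> (\<exists>u. chain c E u es u)"

definition net :: "(real \<times> real) list \<Rightarrow> real" where
  "net es = (\<Sum>e\<leftarrow>es. snd e - fst e)"

lemma net_simps [simp]: "net [] = 0" "net (e # es) = snd e - fst e + net es" "net (es @ fs) = net es + net fs"
  by (simp_all add: net_def)

lemma chain_append: "chain c E u (es @ fs) v \<longleftrightarrow> (\<exists>w. chain c E u es w \<and> chain c E w fs v)"
  by (induction es arbitrary: u) auto

lemma chain_subset: "chain c E u es v \<Longrightarrow> set es \<subseteq> E"
  by (induction es arbitrary: u) auto

lemma closed_chain_subset: "closed_chain c E es \<Longrightarrow> set es \<subseteq> E"
  unfolding closed_chain_def by (elim conjE exE) (rule chain_subset)

lemma chain_coarsen: "chain c E u es v \<Longrightarrow> chain (\<lambda>x. g (c x)) E (g u) es (g v)"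
  by (induction es arbitrary: u) auto

lemma closed_chain_coarsen: "closed_chain c E es \<Longrightarrow> closed_chain (\<lambda>x. g (c x)) E es"
  unfolding closed_chain_def using chain_coarsen by metis

lemma closed_chain_split:
  assumes "closed_chain c E es" "\<not> distinct (map (\<lambda>e. c (fst e)) es)"
  obtains es1 es2 where "closed_chain c E es1" "closed_chain c E es2"
    "length es1 < length es" "length es2 < length es" "net es = net es1 + net es2"
proof -
  obtain xs y ys zs where "map (\<lambda>e. c (fst e)) es = xs @ [y] @ ys @ [y] @ zs"
    using not_distinct_decomp[OF assms(2)] by blast
  then obtain A a B b C where es: "es = A @ a # B @ b # C" and y: "c (fst a) = y" "c (fst b) = y"
    by (auto simp: map_eq_append_conv map_eq_Cons_conv append_eq_map_conv Cons_eq_map_conv)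
  obtain u where "chain c E u es u" using assms(1) by (auto simp: closed_chain_def)
  then have "chain c E y (a # B) y" "chain c E u (A @ b # C) u"
    unfolding es by (auto simp: chain_append y)
  then have "closed_chain c E (a # B)" "closed_chain c E (A @ b # C)"
    by (auto simp: closed_chain_def)
  then show thesis by (rule that) (simp_all add: es)
qed

text \<open>Cutting at repeated cells until there are none leaves closed chains whose length is at most the
  number of cells.\<close>

lemma net_in_span_short:
  assumes "closed_chain c E es" and fin: "finite (c ` fst ` E)"
  shows "net es \<in> rat_real.span {net fs | fs. closed_chain c E fs \<and> length fs \<le> card (c ` fst ` E)}"
  using assms(1)
proof (induction "length es" arbitrary: es rule: less_induct)
  case less
  show ?case
  proof (cases "distinct (map (\<lambda>e. c (fst e)) es)")
    case True
    then have "length es = card (set (map (\<lambda>e. c (fst e)) es))" using distinct_card[OF True] by (simp only: length_map)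
    also have "\<dots> \<le> card (c ` fst ` E)"
    proof (rule card_mono[OF fin])
      have "set es \<subseteq> E" using less.prems by (rule closed_chain_subset)
      then show "set (map (\<lambda>e. c (fst e)) es) \<subseteq> c ` fst ` E" by auto
    qed
    finally show ?thesis using less.prems by (intro rat_real.span_base) blast
  next
    case False
    from closed_chain_split[OF less.prems False] obtain es1 es2 where
      "closed_chain c E es1" "closed_chain c E es2" "length es1 < length es" "length es2 < length es"
      "net es = net es1 + net es2" .
    with less.hyps show ?thesis by (simp add: rat_real.span_add)
  qed
qed

definition cell :: "nat \<Rightarrow> real \<Rightarrow> int" where
  "cell n x = \<lfloor>2 ^ n * x\<rfloor>"

lemma cell_Suc: "cell n x = cell (Suc n) x div 2"
proof -
  have "cell n x = \<lfloor>2 ^ Suc n * x / real_of_int 2\<rfloor>" by (simp add: cell_def)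
  also have "\<dots> = cell (Suc n) x div 2" unfolding cell_def by (subst floor_divide_real_eq_div) auto
  finally show ?thesis .
qed

lemma closed_chain_cell_mono:
  assumes "m \<le> n" "closed_chain (cell n) E es"
  shows "closed_chain (cell m) E es"
  using assms
proof (induction n rule: dec_induct)
  case (step n)
  have "closed_chain (\<lambda>x. cell (Suc n) x div 2) E es"
    using step.prems by (rule closed_chain_coarsen[where g = "\<lambda>k. k div 2"])
  then have "closed_chain (cell n) E es" by (simp flip: cell_Suc)
  then show ?case by (rule step.IH)
qed

text \<open>Each jump moves a point by less than the length of a cell.\<close>

lemma chain_net_bound:
  "chain (cell n) E u es v \<Longrightarrow> \<bar>2 ^ n * net es - of_int (v - u)\<bar> \<le> real (length es)"
proof (induction es arbitrary: u)
  case (Cons e es)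
  then have IH: "\<bar>2 ^ n * net es - of_int (v - cell n (snd e))\<bar> \<le> real (length es)"
    and u: "u = cell n (fst e)" by auto
  have "\<bar>2 ^ n * (snd e - fst e) - of_int (cell n (snd e) - cell n (fst e))\<bar> \<le> 1"
    unfolding cell_def right_diff_distrib by linarith
  with IH show ?case by (simp add: u distrib_left)
qed simp

lemma closed_chain_net_bound:
  assumes "closed_chain (cell n) E es"
  shows "\<bar>net es\<bar> \<le> real (length es) / 2 ^ n"
proof -
  obtain u where "chain (cell n) E u es u" using assms by (auto simp: closed_chain_def)
  from chain_net_bound[OF this] show ?thesis
    by (simp add: abs_mult field_simps)
qed

section \<open>The steps of an \<open>(\<alpha>\<^sub>1, \<dots>, \<alpha>\<^sub>l)\<close>-set\<close>

text \<open>Representatives in \<open>[0, 1)\<close> turn the steps on the circle into steps on the line with finitely many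
  possible increments.\<close>

definition lift_set :: "circle set \<Rightarrow> real set" where
  "lift_set K = {x. 0 \<le> x \<and> x < 1 \<and> to_circle x \<in> K}"

definition steps :: "nat \<Rightarrow> (nat \<Rightarrow> real) \<Rightarrow> circle set \<Rightarrow> (real \<times> real) set" where
  "steps l \<alpha> K = {(p, q). p \<in> lift_set K \<and> q \<in> lift_set K \<and> (\<exists>i\<in>{1..l}. q - p - \<alpha> i \<in> \<int>)}"

lemma cell_unit_interval: "cell n ` fst ` steps l \<alpha> K \<subseteq> cell n ` lift_set K" "cell n ` lift_set K \<subseteq> {0..2 ^ n}"
proof -
  show "cell n ` fst ` steps l \<alpha> K \<subseteq> cell n ` lift_set K" by (auto simp: steps_def)
  have "cell n x \<in> {0..2 ^ n}" if "0 \<le> x" "x < 1" for x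
  proof -
    have "cell n x \<le> cell n 1" unfolding cell_def using that by (intro floor_mono mult_left_mono) auto
    moreover have "cell n 1 = 2 ^ n" by (simp add: cell_def)
    ultimately show ?thesis using that by (simp add: cell_def)
  qed
  then show "cell n ` lift_set K \<subseteq> {0..2 ^ n}" by (auto simp: lift_set_def)
qed

lemma finite_cells: "finite (cell n ` lift_set K)" "finite (cell n ` fst ` steps l \<alpha> K)"
  using cell_unit_interval finite_subset by (metis finite_atLeastAtMost_int)+

lemma steps_alphabet:
  obtains A where "finite A" "A \<subseteq> rat_real.span (insert 1 (\<alpha> ` {1..l}))"
    "\<And>K e. e \<in> steps l \<alpha> K \<Longrightarrow> snd e - fst e \<in> A"
proof -
  define A where "A = (\<Union>i\<in>{1..l}. (\<lambda>k. \<alpha> i + of_int k) ` {- \<lceil>\<bar>\<alpha> i\<bar>\<rceil> - 1..\<lceil>\<bar>\<alpha> i\<bar>\<rceil> + 1})"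
  have "finite A" by (simp add: A_def)
  moreover have "A \<subseteq> rat_real.span (insert 1 (\<alpha> ` {1..l}))"
  proof
    fix a assume "a \<in> A"
    then obtain i k where "i \<in> {1..l}" "a = \<alpha> i + of_rat (of_int k) * 1" by (auto simp: A_def)
    then show "a \<in> rat_real.span (insert 1 (\<alpha> ` {1..l}))"
      by (metis rat_real.span_add rat_real.span_base rat_real.span_scale imageI insertCI)
  qed
  moreover have "snd e - fst e \<in> A" if e: "e \<in> steps l \<alpha> K" for K e
  proof -
    obtain i where i: "i \<in> {1..l}" "snd e - fst e - \<alpha> i \<in> \<int>" and
      "0 \<le> fst e" "fst e < 1" "0 \<le> snd e" "snd e < 1"
      using e by (auto simp: steps_def lift_set_def)
    obtain k where k: "snd e - fst e - \<alpha> i = of_int k" using i(2) by (auto elim: Ints_cases)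
    then have "\<bar>real_of_int k\<bar> \<le> \<bar>\<alpha> i\<bar> + 1"
      using \<open>0 \<le> fst e\<close> \<open>fst e < 1\<close> \<open>0 \<le> snd e\<close> \<open>snd e < 1\<close> by linarith
    then have "k \<in> {- \<lceil>\<bar>\<alpha> i\<bar>\<rceil> - 1..\<lceil>\<bar>\<alpha> i\<bar>\<rceil> + 1}" by simp linarith
    moreover have "snd e - fst e = \<alpha> i + of_int k" using k by simp
    ultimately show ?thesis unfolding A_def using i(1) by blast
  qed
  ultimately show thesis using that by blast
qed

text \<open>The sum of a nonempty list of steps is, modulo \<open>1\<close>, a nontrivial combination of the \<open>\<alpha>\<^sub>i\<close> with
  coefficients in the natural numbers.\<close>

lemma net_nonzero:
  assumes ind: "nonneg_rat_independent_mod1 l \<alpha>" and es: "set es \<subseteq> steps l \<alpha> K" "es \<noteq> []"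
  shows "net es \<noteq> 0"
proof -
  have "\<exists>t :: nat \<Rightarrow> nat. net es - (\<Sum>i=1..l. of_nat (t i) * \<alpha> i) \<in> \<int> \<and> (\<Sum>i=1..l. t i) = length es"
    using es(1)
  proof (induction es)
    case Nil
    show ?case by (intro exI[of _ "\<lambda>_. 0"]) simp
  next
    case (Cons e es)
    then obtain t :: "nat \<Rightarrow> nat" where t: "net es - (\<Sum>i=1..l. of_nat (t i) * \<alpha> i) \<in> \<int>" "(\<Sum>i=1..l. t i) = length es"
      by auto
    obtain j where j: "j \<in> {1..l}" "snd e - fst e - \<alpha> j \<in> \<int>" using Cons.prems by (auto simp: steps_def)
    have "(\<Sum>i=1..l. of_nat ((t(j := Suc (t j))) i) * \<alpha> i) = (\<Sum>i=1..l. of_nat (t i) * \<alpha> i + (if i = j then \<alpha> j else 0))"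
      by (intro sum.cong) (auto simp: algebra_simps)
    also have "\<dots> = (\<Sum>i=1..l. of_nat (t i) * \<alpha> i) + \<alpha> j" using j(1) by (simp add: sum.distrib)
    finally have 1: "net (e # es) - (\<Sum>i=1..l. of_nat ((t(j := Suc (t j))) i) * \<alpha> i)
        = (snd e - fst e - \<alpha> j) + (net es - (\<Sum>i=1..l. of_nat (t i) * \<alpha> i))" by simp
    have "(\<Sum>i=1..l. (t(j := Suc (t j))) i) = (\<Sum>i=1..l. t i + (if i = j then 1 else 0))"
      by (intro sum.cong) auto
    also have "\<dots> = length (e # es)" using j(1) t(2) by (simp add: sum.distrib)
    finally have 2: "(\<Sum>i=1..l. (t(j := Suc (t j))) i) = length (e # es)" .
    have "net (e # es) - (\<Sum>i=1..l. of_nat ((t(j := Suc (t j))) i) * \<alpha> i) \<in> \<int>"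
      unfolding 1 by (rule Ints_add[OF j(2) t(1)])
    with 2 show ?case by blast
  qed
  then obtain t :: "nat \<Rightarrow> nat" where t: "net es - (\<Sum>i=1..l. of_nat (t i) * \<alpha> i) \<in> \<int>" "(\<Sum>i=1..l. t i) = length es"
    by blast
  show ?thesis
  proof
    assume "net es = 0"
    then have "(\<Sum>i=1..l. of_nat (t i) * \<alpha> i) \<in> \<int>" using t(1) by simp
    then have int: "(\<Sum>i=1..l. of_rat (of_nat (t i)) * \<alpha> i) \<in> \<int>" by (simp only: of_rat_of_nat_eq)
    have "\<forall>i\<in>{1..l}. (of_nat (t i) :: rat) = 0"
      by (rule mp[OF spec[OF ind[unfolded nonneg_rat_independent_mod1_def], of "\<lambda>i. of_nat (t i)"]])
        (intro conjI ballI of_nat_0_le_iff int)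
    then have "(\<Sum>i=1..l. t i) = 0" by simp
    with t(2) es(2) show False by simp
  qed
qed

text \<open>An orbit returns to one of the finitely many cells.\<close>

lemma closed_chain_exists:
  assumes K: "alpha_set l \<alpha> K"
  obtains es where "closed_chain (cell n) (steps l \<alpha> K) es"
proof -
  obtain i :: "nat \<Rightarrow> nat" and \<xi> where
    orbit: "\<And>n. i n \<in> {1..l}" "\<And>n. to_circle (\<xi> + (\<Sum>m<n. \<alpha> (i m))) \<in> K"
    using alpha_set_orbit[OF K] by blast
  define x where "x n = frac (\<xi> + (\<Sum>m<n. \<alpha> (i m)))" for n
  have x: "x n \<in> lift_set K" for n
    using orbit(2)[of n] by (simp add: x_def lift_set_def frac_lt_1)
  have "x (Suc n) - x n - \<alpha> (i n) \<in> \<int>" for n by (simp add: x_def frac_def)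
  then have step: "(x n, x (Suc n)) \<in> steps l \<alpha> K" for n
    using x orbit(1)[of n] unfolding steps_def by blast
  have path: "chain (cell n) (steps l \<alpha> K) (cell n (x m)) (map (\<lambda>j. (x j, x (Suc j))) [m..<m + k]) (cell n (x (m + k)))" for m k
    by (induction k) (auto simp: chain_append step)
  have "finite (range (\<lambda>j. cell n (x j)))"
    by (rule finite_subset[OF _ finite_cells(1)[of n K]]) (use x in blast)
  then have "\<not> inj (\<lambda>j. cell n (x j))" using finite_imageD infinite_UNIV_nat by blast
  then obtain m m' where "m < m'" "cell n (x m) = cell n (x m')"
    by (metis (mono_tags, lifting) injI linorder_neqE_nat)
  with path[of m "m' - m"] show thesis
    by (intro that[of "map (\<lambda>j. (x j, x (Suc j))) [m..<m']"]) (auto simp: closed_chain_def)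
qed

text \<open>The rational spans of the sums of closed chains decrease as the cells are refined, so from
  some scale on their dimension is a constant \<open>s\<close>. From there on, with \<open>N\<close> cells of length
  \<open>2 ^ - n\<close>, there are \<open>s\<close> independent sums from closed chains of length at most \<open>N\<close>; they lie in one
  fixed \<open>s\<close>-dimensional space and are at most \<open>N / 2 ^ n\<close> in absolute value. The bound for sums from a
  finite alphabet then reads \<open>C \<le> N ^ (s - 1) * (N / 2 ^ n)\<close>.\<close>

lemma cells_lower_bound:
  assumes ind: "nonneg_rat_independent_mod1 l \<alpha>" and K: "alpha_set l \<alpha> K"
  obtains C :: real and s n0 :: nat where "C > 0" "1 \<le> s" "s \<le> rat_rank l \<alpha> + 1"
    "\<And>n. n \<ge> n0 \<Longrightarrow> C * 2 ^ n \<le> real (card (cell n ` lift_set K)) ^ s"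
proof -
  let ?E = "steps l \<alpha> K" and ?V = "insert 1 (\<alpha> ` {1..l})"
  define N where "N n = card (cell n ` fst ` ?E)" for n
  define L where "L n = {net es | es. closed_chain (cell n) ?E es}" for n
  define S where "S n = {net es | es. closed_chain (cell n) ?E es \<and> length es \<le> N n}" for n
  obtain A where A: "finite A" "A \<subseteq> rat_real.span ?V" "\<And>e. e \<in> ?E \<Longrightarrow> snd e - fst e \<in> A"
    using steps_alphabet[of \<alpha> l] by metis
  have word: "\<exists>as. set as \<subseteq> A \<and> length as \<le> length es \<and> net es = sum_list as"
    if "closed_chain (cell n) ?E es" for es n
  proof -
    have "set es \<subseteq> ?E" using that by (rule closed_chain_subset)
    then show ?thesis using A(3) by (intro exI[of _ "map (\<lambda>e. snd e - fst e) es"]) (auto simp: net_def)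
  qed
  have LA: "L n \<subseteq> rat_real.span A" for n
  proof
    fix w assume "w \<in> L n"
    then obtain as where "set as \<subseteq> A" "w = sum_list as" using word unfolding L_def by blast
    moreover have "sum_list as \<in> rat_real.span A" if "set as \<subseteq> A" for as
      using that by (induction as) (auto simp: rat_real.span_zero rat_real.span_base rat_real.span_add)
    ultimately show "w \<in> rat_real.span A" by simp
  qed
  have LS: "L n \<subseteq> rat_real.span (S n)" for n
    unfolding L_def S_def N_def using net_in_span_short finite_cells(2) by blast
  have SL: "S n \<subseteq> L n" for n by (auto simp: S_def L_def)
  have "\<forall>n. \<exists>B. B \<subseteq> S n \<and> rat_real.independent B \<and> S n \<subseteq> rat_real.span B"
    using rat_real.maximal_independent_subset by metis
  from choice[OF this] obtain B where
    B: "\<And>n. B n \<subseteq> S n" "\<And>n. rat_real.independent (B n)" "\<And>n. S n \<subseteq> rat_real.span (B n)"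
    by blast
  have BA: "B n \<subseteq> rat_real.span A" for n using B(1) SL LA by blast
  have finB: "finite (B n)" for n
    using rat_real.independent_span_bound[OF A(1) B(2) BA] by blast
  have LB: "L n \<subseteq> rat_real.span (B n)" for n
    using LS[of n] rat_real.span_minimal[OF B(3) rat_real.subspace_span, of n] by blast
  define n0 where "n0 = (ARG_MIN (\<lambda>n. card (B n)) n. True)"
  have min: "card (B n0) \<le> card (B n)" for n
    unfolding n0_def by (rule arg_min_nat_le) simp
  define s where "s = card (B n0)"
  have "B n0 \<noteq> {}"
  proof
    assume "B n0 = {}"
    then have "L n0 \<subseteq> {0}" using LB[of n0] by simp
    moreover obtain es where es: "closed_chain (cell n0) ?E es" using closed_chain_exists[OF K] .
    then have "net es \<in> L n0" by (auto simp: L_def)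
    moreover have "net es \<noteq> 0"
      using closed_chain_subset[OF es] es by (intro net_nonzero[OF ind]) (auto simp: closed_chain_def)
    ultimately show False by blast
  qed
  then have s1: "s \<ge> 1" using finB by (simp add: s_def Suc_leI card_gt_0_iff)
  have sr: "s \<le> rat_rank l \<alpha> + 1"
  proof -
    obtain B' where B': "B' \<subseteq> ?V" "?V \<subseteq> rat_real.span B'" "card B' = rat_real.dim ?V"
      using rat_real.basis_exists[of ?V] by metis
    have "finite B'" using B'(1) finite_subset by fastforce
    have "rat_real.span ?V \<subseteq> rat_real.span B'"
      using B'(2) by (simp add: rat_real.span_minimal)
    moreover have "rat_real.span A \<subseteq> rat_real.span ?V" using A(2) by (simp add: rat_real.span_minimal)
    ultimately have "B n0 \<subseteq> rat_real.span B'" using BA by blast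
    from rat_real.independent_span_bound[OF \<open>finite B'\<close> B(2) this]
    have "s \<le> card B'" by (simp add: s_def)
    then show ?thesis using B'(3) by (simp add: rat_rank_def)
  qed
  obtain C where C: "C > 0"
    "\<And>W X \<eta>. finite W \<Longrightarrow> card W = card (B n0) \<Longrightarrow> rat_real.independent W \<Longrightarrow> W \<subseteq> rat_real.span (B n0) \<Longrightarrow> X \<ge> 1 \<Longrightarrow>
      (\<And>w. w \<in> W \<Longrightarrow> \<bar>w\<bar> \<le> \<eta> \<and> (\<exists>as. set as \<subseteq> A \<and> length as \<le> X \<and> w = sum_list as)) \<Longrightarrow>
      C \<le> real X ^ (card (B n0) - 1) * \<eta>"
    using independent_sums_bound[OF A(1) finB \<open>B n0 \<noteq> {}\<close> B(2) BA] by blast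
  have "C * 2 ^ n \<le> real (card (cell n ` lift_set K)) ^ s" if n: "n \<ge> n0" for n
  proof -
    obtain W where W: "W \<subseteq> B n" "card W = s" "finite W"
      using obtain_subset_with_card_n[OF min[of n]] by (auto simp: s_def)
    have "W \<noteq> {}" using s1 W(2) by auto
    moreover have "W \<subseteq> S n" using W(1) B(1) by blast
    ultimately obtain es where "closed_chain (cell n) ?E es" "length es \<le> N n" by (auto simp: S_def)
    then have "N n \<ge> 1" by (cases es) (auto simp: closed_chain_def)
    have "L n \<subseteq> L n0" using closed_chain_cell_mono[OF n] by (auto simp: L_def)
    then have "W \<subseteq> rat_real.span (B n0)" using \<open>W \<subseteq> S n\<close> SL LB by blast
    moreover have "rat_real.independent W" using W(1) B(2) rat_real.independent_mono by blast
    moreover have "\<bar>w\<bar> \<le> real (N n) / 2 ^ n \<and> (\<exists>as. set as \<subseteq> A \<and> length as \<le> N n \<and> w = sum_list as)"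
      if "w \<in> W" for w
    proof -
      obtain es where es: "closed_chain (cell n) ?E es" "length es \<le> N n" "w = net es"
        using subsetD[OF \<open>W \<subseteq> S n\<close> \<open>w \<in> W\<close>] unfolding S_def by blast
      have "\<bar>w\<bar> \<le> real (length es) / 2 ^ n" using closed_chain_net_bound es by blast
      also have "\<dots> \<le> real (N n) / 2 ^ n" using es(2) by (simp add: divide_right_mono)
      finally show ?thesis using word[OF es(1)] es(2,3) order_trans by blast
    qed
    ultimately have "C \<le> real (N n) ^ (s - 1) * (real (N n) / 2 ^ n)"
      using C(2)[of W "N n" "real (N n) / 2 ^ n"] W(2,3) \<open>N n \<ge> 1\<close> by (simp add: s_def)
    then have "C * 2 ^ n \<le> real (N n) ^ (s - 1) * real (N n)" by (simp add: field_simps)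
    also have "\<dots> = real (N n) ^ s" using s1 by (metis One_nat_def Suc_pred less_eq_Suc_le power_Suc2)
    also have "\<dots> \<le> real (card (cell n ` lift_set K)) ^ s"
      unfolding N_def by (intro power_mono of_nat_mono card_mono finite_cells cell_unit_interval) simp
    finally show ?thesis .
  qed
  with that[OF C(1) s1 sr] show thesis by blast
qed

text \<open>A set of diameter at most the length of a cell meets a bounded number of cells: the integers
  \<open>k\<close> and \<open>j\<close> below account for the identification of \<open>0\<close> with \<open>1\<close> and for neighbouring cells.\<close>

lemma card_cells_le_covering_number:
  assumes "0 < \<delta>" "\<delta> \<le> 1 / 2 ^ n"
  shows "card (cell n ` lift_set K) \<le> 9 * covering_number K \<delta>"
proof -
  obtain \<U> where \<U>: "finite \<U>" "card \<U> = covering_number K \<delta>" "K \<subseteq> \<Union>\<U>"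
    "\<And>U. U \<in> \<U> \<Longrightarrow> bounded U \<and> diameter U \<le> \<delta>"
    using covering_number_attained[OF \<open>\<delta> > 0\<close>] by metis
  have nine: "card (cell n ` lift_set U) \<le> 9" if U: "U \<in> \<U>" for U
  proof (cases "lift_set U = {}")
    case False
    then obtain x0 where x0: "x0 \<in> lift_set U" by blast
    define F where "F = (\<lambda>(k, j). cell n x0 + k * 2 ^ n + j) ` ({-1..1::int} \<times> {-1..1::int})"
    have "cell n x \<in> F" if x: "x \<in> lift_set U" for x
    proof -
      define k where "k = round (x - x0)"
      have bds: "0 \<le> x" "x < 1" "0 \<le> x0" "x0 < 1" using x x0 by (auto simp: lift_set_def)
      have "dist (to_circle x) (to_circle x0) \<le> diameter U"
        using x x0 \<U>(4)[OF U] by (intro diameter_bounded_bound) (auto simp: lift_set_def)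
      then have "\<bar>x - x0 - of_int k\<bar> \<le> 1 / 2 ^ n"
        using \<U>(4)[OF U] assms(2) by (simp add: dist_to_circle k_def)
      then have near: "\<bar>2 ^ n * x - (2 ^ n * x0 + of_int (k * 2 ^ n))\<bar> \<le> 1"
        by (simp add: abs_le_iff field_simps)
      have "\<bar>of_int k - (x - x0)\<bar> \<le> 1 / 2" unfolding k_def by (rule of_int_round_abs_le)
      then have "\<bar>real_of_int k\<bar> < 2" using bds by linarith
      then have "k \<in> {-1..1}" by auto
      moreover have "cell n x - cell n x0 - k * 2 ^ n \<in> {-1..1}"
      proof -
        define h where "h = k * 2 ^ n"
        have "\<lfloor>2 ^ n * x\<rfloor> - \<lfloor>2 ^ n * x0\<rfloor> - h \<le> 1" "-1 \<le> \<lfloor>2 ^ n * x\<rfloor> - \<lfloor>2 ^ n * x0\<rfloor> - h"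
          using near unfolding h_def[symmetric] by linarith+
        then show ?thesis by (simp add: cell_def h_def)
      qed
      ultimately show ?thesis
        unfolding F_def by (intro image_eqI[of _ _ "(k, cell n x - cell n x0 - k * 2 ^ n)"]) auto
    qed
    then have "card (cell n ` lift_set U) \<le> card F" by (intro card_mono) (auto simp: F_def)
    also have "\<dots> \<le> card ({-1..1::int} \<times> {-1..1::int})" unfolding F_def by (intro card_image_le) simp
    finally show ?thesis by (simp add: card_cartesian_product)
  qed simp
  have "cell n ` lift_set K \<subseteq> (\<Union>U\<in>\<U>. cell n ` lift_set U)"
  proof (rule image_subsetI)
    fix x assume x: "x \<in> lift_set K"
    then obtain U where "U \<in> \<U>" "to_circle x \<in> U" using \<U>(3) unfolding lift_set_def by blast
    with x show "cell n x \<in> (\<Union>U\<in>\<U>. cell n ` lift_set U)" unfolding lift_set_def by blast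
  qed
  then have "card (cell n ` lift_set K) \<le> card (\<Union>U\<in>\<U>. cell n ` lift_set U)"
    using \<U>(1) finite_cells(1) by (intro card_mono) auto
  also have "\<dots> \<le> (\<Sum>U\<in>\<U>. card (cell n ` lift_set U))" using \<U>(1) by (rule card_UN_le)
  also have "\<dots> \<le> (\<Sum>U\<in>\<U>. 9)" using nine by (rule sum_mono)
  also have "\<dots> = 9 * covering_number K \<delta>" using \<U>(2) by simp
  finally show ?thesis .
qed

lemma lower_box_dim_rank:
  assumes ind: "nonneg_rat_independent_mod1 l \<alpha>" and K: "alpha_set l \<alpha> K"
  shows "lower_box_dim K \<ge> ereal (1 / (real (rat_rank l \<alpha>) + 1))"
proof -
  obtain C s n0 where C: "C > 0" "1 \<le> s" "s \<le> rat_rank l \<alpha> + 1"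
    "\<And>n. n \<ge> n0 \<Longrightarrow> C * 2 ^ n \<le> real (card (cell n ` lift_set K)) ^ s"
    using cells_lower_bound[OF ind K] by metis
  have "C / (2 * 9 ^ s) / \<delta> \<le> real (covering_number K \<delta>) ^ s" if \<delta>: "0 < \<delta>" "\<delta> < 1 / 2 ^ n0" for \<delta>
  proof -
    define n where "n = nat \<lfloor>log 2 (1 / \<delta>)\<rfloor>"
    have "real n0 = log 2 (2 ^ n0)" by simp
    also have "\<dots> \<le> log 2 (1 / \<delta>)" using \<delta> by (intro log_mono) (auto simp: field_simps)
    finally have n0: "real n0 \<le> log 2 (1 / \<delta>)" .
    then have n: "n \<ge> n0" "real n \<le> log 2 (1 / \<delta>)" "log 2 (1 / \<delta>) < real (Suc n)"
      unfolding n_def by (simp_all add: le_nat_floor) linarith+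
    then have "2 powr real n \<le> 1 / \<delta>" "1 / \<delta> < 2 powr real (Suc n)"
      using \<delta>(1) by (simp_all add: le_log_iff log_less_iff del: of_nat_Suc)
    then have pow: "2 ^ n \<le> 1 / \<delta>" "1 / \<delta> < 2 ^ Suc n"
      by (simp_all only: powr_realpow zero_less_numeral)
    have "C / 2 / \<delta> = C / 2 * (1 / \<delta>)" by simp
    also have "\<dots> \<le> C / 2 * 2 ^ Suc n" using pow(2) C(1) by (intro mult_left_mono) auto
    also have "\<dots> = C * 2 ^ n" by simp
    also have "\<dots> \<le> real (card (cell n ` lift_set K)) ^ s" by (rule C(4)[OF n(1)])
    also have "\<dots> \<le> real (9 * covering_number K \<delta>) ^ s"
      using pow(1) \<delta>(1) by (intro power_mono of_nat_mono card_cells_le_covering_number) (auto simp: field_simps)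
    also have "\<dots> = 9 ^ s * real (covering_number K \<delta>) ^ s" by (simp add: power_mult_distrib)
    finally have "(C / 2 / \<delta>) / 9 ^ s \<le> real (covering_number K \<delta>) ^ s"
      by (simp add: pos_divide_le_eq mult.commute del: divide_divide_eq_left)
    then show ?thesis by (simp add: mult_ac)
  qed
  then have "lower_box_dim K \<ge> ereal (1 / real s)"
    using C(1,2) by (intro lower_box_dim_ge[of s "C / (2 * 9 ^ s)" "1 / 2 ^ n0"]) auto
  moreover have "1 / (real (rat_rank l \<alpha>) + 1) \<le> 1 / real s"
  proof -
    have "real s \<le> real (rat_rank l \<alpha>) + 1" using C(3) by linarith
    then show ?thesis using C(2) by (intro divide_left_mono) auto
  qed
  ultimately show ?thesis by (meson ereal_less_eq(3) order_trans)
qed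

section \<open>Dimension of \<open>(\<alpha>\<^sub>1, \<dots>, \<alpha>\<^sub>l)\<close>-sets\<close>

theorem corollary1p6:
  fixes l r :: nat and \<alpha> :: "nat \<Rightarrow> real" and K :: "circle set"
  assumes "l \<ge> 2"
    and "nonneg_rat_independent_mod1 l \<alpha>"
    and "alpha_set l \<alpha> K"
    and "r = rat_rank l \<alpha>"
  shows "(l = 2 \<longrightarrow>
            (difference_set K = UNIV \<or> interior K \<noteq> {}) \<and> lower_box_dim K \<ge> 1 / 2)
       \<and> lower_box_dim K \<ge> (if r = 1 then 1 else ereal (1 / (real r + 1)))"
proof (intro conjI impI)
  have half: "(1 / 2 :: ereal) \<le> 1"
    by (simp add: one_ereal_def numeral_eq_ereal)
  assume "l = 2"
  then show two: "difference_set K = UNIV \<or> interior K \<noteq> {}"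
    using difference_set_or_interior_two assms(2,3) by blast
  then show "lower_box_dim K \<ge> 1 / 2"
    using lower_box_dim_difference_set lower_box_dim_interior half order_trans by blast
next
  show "lower_box_dim K \<ge> (if r = 1 then 1 else ereal (1 / (real r + 1)))"
  proof (cases "r = 1")
    case True
    then show ?thesis
      using lower_box_dim_interior[OF interior_rank_one[OF assms(2,3)]] assms(4) by simp
  next
    case False
    then show ?thesis
      using lower_box_dim_rank[OF assms(2,3)] assms(4) by simp
  qed
qed

end
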